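(* The randomized competitive ratio of Weighted $k$-Server -- Revealed Service Pattern (W$k$S-RSP) on uniform metrics is $\Omega(2^k)$: there is an absolute constant $c>0$ such that for every $k\ge 1$ there exist server weights and a finite uniform metric space for which no randomized online algorithm for W$k$S-RSP is $\alpha$-competitive with $\alpha< c\cdot 2^k$.
   Context: Uniform metric: a finite set $U$ of points, every two distinct points at distance $1$. There are $k$ servers, server $i$ has weight $w_i$ with $w_1\le\dots\le w_k$; the cost of a solution is $\sum_i w_i\cdot(\text{number of moves of server } i)$. A (hierarchical) service pattern over $[1,T+1)$ is a $k$-tuple $\mathcal I=(\mathcal I^1,\dots,\mathcal I^k)$ where each level $\mathcal I^\ell$ is a partition of $[1,T+1)$ into left-closed right-open intervals with integer endpoints, and $\mathcal I^\ell$ refines $\mathcal I^{\ell+1}$ for each $\ell<k$. Its cost is $\sum_\ell w_\ell|\mathcal I^\ell|$. A labeling is a function from the multiset $\mathcal I^1\uplus\dots\uplus\mathcal I^k$ to $U$; it is feasible with respect to $(\sigma_1,\dots,\sigma_T)$ if for each $t$ some interval containing $t$ is labeled $\sigma_t$; a pattern is feasible if it has a feasible labeling. The $\ell$-extension of a pattern $\mathcal I_{t-1}$ over $[1,t)$ is the pattern over $[1,t+1)$ obtained by adding $[t,t+1)$ as a new interval to each level $i\le\ell$ and extending the last interval of each level $i>\ell$ by $[t,t+1)$. W$k$S-RSP: in round $t$ the online algorithm receives $(\sigma_t,\ell_t)$, with the guarantee that the revealed pattern $\mathcal I_t$ (the $\ell_t$-extension of $\mathcal I_{t-1}$) is feasible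 with respect to $(\sigma_1,\dots,\sigma_t)$; it must move its servers so that some server is at $\sigma_t$. A randomized algorithm is $\alpha$-competitive if on every input its expected cost is at most $\alpha$ times the cost of the final revealed pattern plus an additive constant independent of the input. *)

theory Defs
  imports "HOL-Probability.Probability"
begin

text \<open>
  Servers and levels are indexed by \<open>1, \<dots>, k\<close>. The half-open interval \<open>[a, b)\<close> with
  integer end points is represented by the set \<open>{a..<b}\<close> of the rounds it contains, and a
  \<open>k\<close>-tuple of levels by a function on \<open>nat\<close> of which only the values on \<open>{1..k}\<close> matter.
\<close>

type_synonym pattern = "nat \<Rightarrow> nat set set"

definition service_pattern :: "nat \<Rightarrow> nat \<Rightarrow> pattern \<Rightarrow> bool" where
  "service_pattern k T I \<longleftrightarrow>
     (\<forall>l\<in>{1..k}. partition_on {1..<T + 1} (I l) \<and> (\<forall>J\<in>I l. \<exists>a b. J = {a..<b})) \<and>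
     (\<forall>l\<in>{1..<k}. refines {1..<T + 1} (I l) (I (l + 1)))"

definition pattern_cost :: "nat \<Rightarrow> (nat \<Rightarrow> real) \<Rightarrow> pattern \<Rightarrow> real" where
  "pattern_cost k w I = (\<Sum>l = 1..k. w l * real (card (I l)))"

text \<open>
  A labeling takes the level as an additional argument: an interval occurring on several levels
  carries an independent label on each of them (disjoint union of the levels).
\<close>

definition labeling :: "nat \<Rightarrow> 'p set \<Rightarrow> pattern \<Rightarrow> (nat \<Rightarrow> nat set \<Rightarrow> 'p) \<Rightarrow> bool" where
  "labeling k U I g \<longleftrightarrow> (\<forall>l\<in>{1..k}. \<forall>J\<in>I l. g l J \<in> U)"

definition feasible_labeling ::
    "nat \<Rightarrow> nat \<Rightarrow> pattern \<Rightarrow> (nat \<Rightarrow> 'p) \<Rightarrow> (nat \<Rightarrow> nat set \<Rightarrow> 'p) \<Rightarrow> bool" where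
  "feasible_labeling k T I \<sigma> g \<longleftrightarrow>
     (\<forall>t\<in>{1..T}. \<exists>l\<in>{1..k}. \<exists>J\<in>I l. t \<in> J \<and> g l J = \<sigma> t)"

definition feasible_pattern ::
    "nat \<Rightarrow> 'p set \<Rightarrow> nat \<Rightarrow> pattern \<Rightarrow> (nat \<Rightarrow> 'p) \<Rightarrow> bool" where
  "feasible_pattern k U T I \<sigma> \<longleftrightarrow>
     (\<exists>g. labeling k U I g \<and> feasible_labeling k T I \<sigma> g)"

text \<open>
  For a pattern over \<open>[1, t)\<close>, the last interval of a level is the one containing \<open>t - 1\<close>.
\<close>

definition extension :: "nat \<Rightarrow> nat \<Rightarrow> pattern \<Rightarrow> pattern" where
  "extension l t I = (\<lambda>i. if i \<le> l then insert {t..<t + 1} (I i)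
     else (\<lambda>J. if t - 1 \<in> J then J \<union> {t..<t + 1} else J) ` I i)"

text \<open>
  An input is a list of pairs \<open>(\<sigma>\<^sub>t, \<ell>\<^sub>t)\<close>; round \<open>t\<close> is the list entry with index \<open>t - 1\<close>.
\<close>

type_synonym 'p input = "('p \<times> nat) list"

primrec revealed_pattern :: "'p input \<Rightarrow> nat \<Rightarrow> pattern" where
  "revealed_pattern \<rho> 0 = (\<lambda>_. {})"
| "revealed_pattern \<rho> (Suc t) = extension (snd (\<rho> ! t)) (Suc t) (revealed_pattern \<rho> t)"

text \<open>
  The empty pattern over \<open>[1, 1)\<close> has no intervals that could be extended, so the requirement
  that the revealed objects are service patterns amounts to \<open>\<ell>\<^sub>1 = k\<close>.
\<close>

definition valid_input :: "nat \<Rightarrow> 'p set \<Rightarrow> 'p input \<Rightarrow> bool" where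
  "valid_input k U \<rho> \<longleftrightarrow>
     (\<forall>t\<in>{1..length \<rho>}. fst (\<rho> ! (t - 1)) \<in> U \<and> snd (\<rho> ! (t - 1)) \<le> k \<and>
        service_pattern k t (revealed_pattern \<rho> t) \<and>
        feasible_pattern k U t (revealed_pattern \<rho> t) (\<lambda>s. fst (\<rho> ! (s - 1))))"

text \<open>
  A deterministic online algorithm maps the history up to and including the current round to the
  positions of the servers at the end of that round; its value on \<open>[]\<close> is the initial
  configuration.
\<close>

type_synonym 'p algorithm = "'p input \<Rightarrow> nat \<Rightarrow> 'p"

definition online_algorithm :: "nat \<Rightarrow> 'p set \<Rightarrow> 'p algorithm \<Rightarrow> bool" where
  "online_algorithm k U A \<longleftrightarrow>
     (\<forall>\<rho>. valid_input k U \<rho> \<longrightarrow>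
        (\<forall>i\<in>{1..k}. A \<rho> i \<in> U) \<and>
        (\<rho> \<noteq> [] \<longrightarrow> (\<exists>i\<in>{1..k}. A \<rho> i = fst (last \<rho>))))"

definition moves :: "'p algorithm \<Rightarrow> 'p input \<Rightarrow> nat \<Rightarrow> nat" where
  "moves A \<rho> i = card {t\<in>{1..length \<rho>}. A (take t \<rho>) i \<noteq> A (take (t - 1) \<rho>) i}"

definition algorithm_cost :: "nat \<Rightarrow> (nat \<Rightarrow> real) \<Rightarrow> 'p algorithm \<Rightarrow> 'p input \<Rightarrow> real" where
  "algorithm_cost k w A \<rho> = (\<Sum>i = 1..k. w i * real (moves A \<rho> i))"

text \<open>
  A randomized online algorithm is a probability distribution over deterministic ones for which
  the position of every server after every valid history is a random variable.
\<close>

definition randomized_algorithm :: "nat \<Rightarrow> 'p set \<Rightarrow> 'p algorithm measure \<Rightarrow> bool" where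
  "randomized_algorithm k U M \<longleftrightarrow>
     prob_space M \<and> (\<forall>A\<in>space M. online_algorithm k U A) \<and>
     (\<forall>\<rho>. valid_input k U \<rho> \<longrightarrow>
        (\<forall>i\<in>{1..k}. (\<lambda>A. A \<rho> i) \<in> measurable M (count_space UNIV)))"

definition competitive ::
    "nat \<Rightarrow> (nat \<Rightarrow> real) \<Rightarrow> 'p set \<Rightarrow> real \<Rightarrow> 'p algorithm measure \<Rightarrow> bool" where
  "competitive k w U \<alpha> M \<longleftrightarrow>
     (\<exists>b. \<forall>\<rho>. valid_input k U \<rho> \<longrightarrow>
        (LINT A|M. algorithm_cost k w A \<rho>) \<le>
          \<alpha> * pattern_cost k w (revealed_pattern \<rho> (length \<rho>)) + b)"

end

theory Submission
  imports Defs
begin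

text \<open>
  The weights are \<open>w\<^sub>l = D\<^sup>l\<close> for a large \<open>D\<close>. An attack of level \<open>l\<close> on a set \<open>P\<close> of \<open>n\<^sub>l\<close> points is a
  request sequence which is cheap for the revealed pattern if some interval above level \<open>l\<close> has its
  label in \<open>P\<close>, but costs an algorithm \<open>w\<^sub>l\<^sub>+\<^sub>1 / 2\<close> in expectation if it has no server above \<open>l\<close> in
  \<open>P\<close>. It consists of many attacks of level \<open>l - 1\<close> on members of a family of subsets of \<open>P\<close> of size
  \<open>n\<^sub>l\<^sub>-\<^sub>1\<close> such that every point is missed by some member, while every \<open>p\<close> in \<open>P\<close> has a companion \<open>q\<close>
  such that all members contain \<open>p\<close> or \<open>q\<close>: a suitable member misses server \<open>l\<close> with probability
  at least \<open>1 / (n\<^sub>l\<^sub>-\<^sub>1 + 1)\<close> each time, whereas the label \<open>q\<close> on level \<open>l\<close> serves all attacks. Such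
  families exist with \<open>n\<^sub>l\<close> about \<open>n\<^sub>l\<^sub>-\<^sub>1\<^sup>2 / 4\<close>, so \<open>n\<^sub>l\<close> is doubly exponential. Finally, an interval of
  level \<open>k\<close> hides its label among up to \<open>2 n\<^sub>k\<^sub>-\<^sub>1\<close> points, and attacks of level \<open>k - 1\<close> halve the set of
  candidates, each time missing server \<open>k\<close> with probability \<open>1/2\<close>. This forces a cost of order
  \<open>w\<^sub>k log n\<^sub>k\<^sub>-\<^sub>1\<close>, that is \<open>2\<^sup>k w\<^sub>k\<close>, against a pattern cost of at most \<open>3 w\<^sub>k\<close>.

  The adversary is oblivious but knows the distribution of the algorithm, so it can choose each
  subset deterministically as the one which the relevant server misses with the largest probability.
\<close>

section \<open>Feasibility and cost of revealed patterns\<close>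

text \<open>
  A configuration \<open>f\<close> gives the label of the current interval on each level; the round \<open>(x, l)\<close> allows
  it to change on the levels up to \<open>l\<close> only.
\<close>

primrec serves :: "nat \<Rightarrow> (nat \<Rightarrow> 'p) \<Rightarrow> 'p input \<Rightarrow> (nat \<Rightarrow> 'p) \<Rightarrow> bool" where
  "serves k f [] f' \<longleftrightarrow> f' = f"
| "serves k f (r # s) f' \<longleftrightarrow>
     (\<exists>g. (\<forall>i. snd r < i \<longrightarrow> g i = f i) \<and> fst r \<in> g ` {1..k} \<and> serves k g s f')"

lemma serves_append:
  "serves k f (s @ t) f'' \<longleftrightarrow> (\<exists>f'. serves k f s f' \<and> serves k f' t f'')"
  by (induction s arbitrary: f) auto

section \<open>Validity of inputs from runs of configurations\<close>

lemma revealed_pattern_cong: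
  "(\<And>i. i < t \<Longrightarrow> \<rho> ! i = \<rho>' ! i) \<Longrightarrow> revealed_pattern \<rho> t = revealed_pattern \<rho>' t"
  by (induction t) auto

lemma feasible_pattern_cong:
  assumes "\<And>s. s \<in> {1..t} \<Longrightarrow> \<sigma> s = \<sigma>' s"
  shows "feasible_pattern k U t I \<sigma> \<longleftrightarrow> feasible_pattern k U t I \<sigma>'"
  unfolding feasible_pattern_def feasible_labeling_def using assms by simp

lemma valid_input_Nil [simp]: "valid_input k U []"
  by (simp add: valid_input_def)

lemma valid_input_append:
  assumes "valid_input k U (\<rho> @ \<rho>')"
  shows "valid_input k U \<rho>"
  unfolding valid_input_def
proof
  fix t assume t: "t \<in> {1..length \<rho>}"
  have nth: "(\<rho> @ \<rho>') ! i = \<rho> ! i" if "i < t" for i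
    using that t by (simp add: nth_append)
  have eq: "revealed_pattern (\<rho> @ \<rho>') t = revealed_pattern \<rho> t"
    by (rule revealed_pattern_cong) (simp add: nth)
  have feas: "feasible_pattern k U t I (\<lambda>s. fst ((\<rho> @ \<rho>') ! (s - 1))) \<longleftrightarrow>
      feasible_pattern k U t I (\<lambda>s. fst (\<rho> ! (s - 1)))" for I
    by (rule feasible_pattern_cong) (auto simp: nth)
  have nth': "(\<rho> @ \<rho>') ! (t - 1) = \<rho> ! (t - 1)" using t by (intro nth) auto
  have "t \<in> {1..length (\<rho> @ \<rho>')}" using t by auto
  from bspec[OF assms[unfolded valid_input_def] this]
  show "fst (\<rho> ! (t - 1)) \<in> U \<and> snd (\<rho> ! (t - 1)) \<le> k \<and>
        service_pattern k t (revealed_pattern \<rho> t) \<and>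
        feasible_pattern k U t (revealed_pattern \<rho> t) (\<lambda>s. fst (\<rho> ! (s - 1)))"
    unfolding eq feas nth' .
qed

lemma partition_on_insert_next:
  assumes "partition_on {1..<t + 1} X"
  shows "partition_on {1..<Suc t + 1} (insert {Suc t..<Suc t + 1} X)"
proof -
  have "{1..<Suc t + 1} = {Suc t..<Suc t + 1} \<union> {1..<t + 1}" by auto
  moreover have "disjnt {Suc t..<Suc t + 1} {1..<t + 1}" by (auto simp: disjnt_def)
  ultimately show ?thesis
    using assms by (auto simp: partition_on_def disjoint_def disjnt_def)
qed

lemma partition_on_extend_last:
  assumes P: "partition_on {1..<t + 1} X" and "t \<noteq> 0"
  shows "partition_on {1..<Suc t + 1} ((\<lambda>J. if t \<in> J then J \<union> {Suc t..<Suc t + 1} else J) ` X)"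
proof -
  have "t \<in> \<Union>X"
    using assms(2) unfolding partition_onD1[OF P, symmetric] by simp
  then obtain L where L: "L \<in> X" "t \<in> L" by blast
  have sub: "J \<subseteq> {1..<t + 1}" if "J \<in> X" for J
    using that partition_onD1[OF P] by blast
  have uniq: "t \<in> J \<longleftrightarrow> J = L" if "J \<in> X" for J
    using disjointD[OF partition_onD2[OF P] that L(1)] L(2) by blast
  have eq: "(\<lambda>J. if t \<in> J then J \<union> {Suc t..<Suc t + 1} else J) ` X =
      insert (insert (Suc t) L) (X - {L})"
  proof -
    have "(\<lambda>J. if t \<in> J then J \<union> {Suc t..<Suc t + 1} else J) ` X =
        (\<lambda>J. if J = L then insert (Suc t) L else J) ` X"
      using uniq by (intro image_cong) auto
    also have "\<dots> = insert (insert (Suc t) L) (X - {L})"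
      using L(1) by auto
    finally show ?thesis .
  qed
  have "\<Union> (insert (insert (Suc t) L) (X - {L})) = insert (Suc t) (\<Union>X)"
    using L by auto
  also have "\<dots> = {1..<Suc t + 1}"
    using P by (auto simp: partition_on_def)
  finally have un: "\<Union> (insert (insert (Suc t) L) (X - {L})) = {1..<Suc t + 1}" .
  have "disjoint (insert (insert (Suc t) L) (X - {L}))"
  proof -
    have "J \<inter> insert (Suc t) L = {}" if "J \<in> X - {L}" for J
    proof -
      have "J \<inter> L = {}" using disjointD[OF partition_onD2[OF P] _ L(1)] that by blast
      moreover have "Suc t \<notin> J" using sub[of J] that by auto
      ultimately show ?thesis by auto
    qed
    moreover have "disjoint (X - {L})"
      using partition_onD2[OF P] by (rule pairwise_subset) auto
    ultimately show ?thesis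
      unfolding pairwise_insert disjnt_def by blast
  qed
  moreover have "{} \<notin> insert (insert (Suc t) L) (X - {L})"
    using P by (auto simp: partition_on_def)
  ultimately show ?thesis
    unfolding eq using un by (simp add: partition_on_def)
qed

text \<open>Refinement is delicate only at level \<open>l\<close>: its new interval lies in the
  extended last interval of level \<open>l + 1\<close>. The empty pattern has no last interval to
  extend, hence the condition on the first round.\<close>

lemma service_pattern_extension:
  assumes I: "service_pattern k t I" and first: "t = 0 \<Longrightarrow> l = k"
  shows "service_pattern k (Suc t) (extension l (Suc t) I)"
proof -
  let ?I = "extension l (Suc t) I"
  have part: "partition_on {1..<t + 1} (I i)" and int: "\<forall>J\<in>I i. \<exists>a b. J = {a..<b}"
    if "i \<in> {1..k}" for i
    using I that by (auto simp: service_pattern_def)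
  have t: "t \<noteq> 0" if "i \<in> {1..k}" "\<not> i \<le> l" for i
    using first that by auto
  have part': "partition_on {1..<Suc t + 1} (?I i)" if i: "i \<in> {1..k}" for i
    using partition_on_insert_next[OF part[OF i]] partition_on_extend_last[OF part[OF i]] t[OF i]
    by (auto simp: extension_def)
  have int': "\<exists>a b. J = {a..<b}" if i: "i \<in> {1..k}" and J: "J \<in> ?I i" for i J
  proof (cases "i \<le> l")
    case True
    then have "J = {Suc t..<Suc t + 1} \<or> J \<in> I i" using J unfolding extension_def by simp
    then show ?thesis using int[OF i] by blast
  next
    case False
    then obtain J' where J': "J' \<in> I i" "J = (if t \<in> J' then J' \<union> {Suc t..<Suc t + 1} else J')"
      using J by (auto simp: extension_def)
    obtain a b where ab: "J' = {a..<b}" using int[OF i] J' by blast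
    have "J' \<subseteq> {1..<t + 1}" using part[OF i] J' by (auto simp: partition_on_def)
    show ?thesis
    proof (cases "t \<in> J'")
      case True
      then have "b = Suc t" using \<open>J' \<subseteq> _\<close> ab atLeastLessThan_subset_iff[of a b 1 "t + 1"]
        by auto
      then have "J = {a..<Suc (Suc t)}" using True ab J' by auto
      then show ?thesis by blast
    qed (use ab J' in auto)
  qed
  have ref: "\<exists>Y\<in>?I (Suc i). J \<subseteq> Y" if i: "i \<in> {1..<k}" and J: "J \<in> ?I i" for i J
  proof -
    have R: "\<exists>Y\<in>I (Suc i). J' \<subseteq> Y" if "J' \<in> I i" for J'
      using I i that by (auto simp: service_pattern_def refines_def)
    have i': "Suc i \<in> {1..k}" "i \<in> {1..k}" using i by auto
    let ?e = "\<lambda>J. if t \<in> J then J \<union> {Suc t..<Suc t + 1} else J"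
    have sub: "J' \<subseteq> ?e J'" for J' by auto
    consider "Suc i \<le> l" | "i = l" | "l < i" by linarith
    then show ?thesis
    proof cases
      case 1
      then show ?thesis using J R by (auto simp: extension_def)
    next
      case 2
      have e: "?I (Suc i) = ?e ` I (Suc i)" using 2 by (simp add: extension_def)
      from J 2 consider "J = {Suc t..<Suc t + 1}" | "J \<in> I i" by (auto simp: extension_def)
      then show ?thesis
      proof cases
        case 1
        have "t \<noteq> 0" using t[OF i'(1)] 2 by auto
        then have "t \<in> \<Union>(I (Suc i))"
          unfolding partition_onD1[OF part[OF i'(1)], symmetric] by simp
        then obtain L where "L \<in> I (Suc i)" "t \<in> L" by blast
        then have "?e L \<in> ?I (Suc i)" "J \<subseteq> ?e L" using 1 unfolding e by auto
        then show ?thesis by blast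
      next
        case 2
        then obtain Y where "Y \<in> I (Suc i)" "J \<subseteq> Y" using R by blast
        then have "?e Y \<in> ?I (Suc i)" "J \<subseteq> ?e Y" using sub[of Y] unfolding e by auto
        then show ?thesis by blast
      qed
    next
      case 3
      have e: "?I (Suc i) = ?e ` I (Suc i)" using 3 by (simp add: extension_def)
      obtain J' where J': "J' \<in> I i" "J = ?e J'" using J 3 by (auto simp: extension_def)
      obtain Y where "Y \<in> I (Suc i)" "J' \<subseteq> Y" using R J' by blast
      then have "?e Y \<in> ?I (Suc i)" "J \<subseteq> ?e Y" using J' unfolding e by auto
      then show ?thesis by blast
    qed
  qed
  show ?thesis
    unfolding service_pattern_def refines_def using part' int' ref by auto
qed

lemma service_pattern_revealed:
  assumes "\<rho> \<noteq> [] \<Longrightarrow> snd (hd \<rho>) = k" "t \<le> length \<rho>"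
  shows "service_pattern k t (revealed_pattern \<rho> t)"
  using assms(2)
proof (induction t)
  case 0
  then show ?case by (auto simp: service_pattern_def refines_def partition_on_def)
next
  case (Suc t)
  then show ?case
    using assms(1) hd_conv_nth[of \<rho>] by (cases "\<rho> = []") (auto intro!: service_pattern_extension)
qed

text \<open>An interval grows only while the configuration keeps its value on that level, and this
  value becomes the label. The clause on intervals containing the last round is the invariant that
  makes the induction go through.\<close>

lemma serves_labeling:
  assumes "serves k f \<rho> f'" "\<rho> \<noteq> [] \<Longrightarrow> snd (hd \<rho>) = k"
  shows "\<exists>g. feasible_labeling k (length \<rho>) (revealed_pattern \<rho> (length \<rho>))
             (\<lambda>s. fst (\<rho> ! (s - 1))) g \<and>
           (\<forall>l\<in>{1..k}. \<forall>J\<in>revealed_pattern \<rho> (length \<rho>) l. length \<rho> \<in> J \<longrightarrow> g l J = f' l)"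
  using assms
proof (induction \<rho> arbitrary: f' rule: rev_induct)
  case Nil
  then show ?case by (auto simp: feasible_labeling_def)
next
  case (snoc r \<rho>)
  define t where "t = length \<rho>"
  define I where "I = revealed_pattern \<rho> t"
  from snoc.prems(1) obtain f1 where f1: "serves k f \<rho> f1" "serves k f1 [r] f'"
    by (auto simp: serves_append)
  have hd: "\<rho> \<noteq> [] \<Longrightarrow> snd (hd \<rho>) = k" using snoc.prems(2) by (cases \<rho>) auto
  from f1(2) have keep: "\<And>i. snd r < i \<Longrightarrow> f' i = f1 i" and srv: "fst r \<in> f' ` {1..k}" by auto
  from snoc.IH[OF f1(1) hd] obtain g
    where g: "feasible_labeling k t I (\<lambda>s. fst (\<rho> ! (s - 1))) g"
      "\<And>l J. l \<in> {1..k} \<Longrightarrow> J \<in> I l \<Longrightarrow> t \<in> J \<Longrightarrow> g l J = f1 l"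
    unfolding t_def I_def by blast
  have rev: "revealed_pattern (\<rho> @ [r]) (Suc t) = extension (snd r) (Suc t) I"
    using revealed_pattern_cong[of t "\<rho> @ [r]" \<rho>] by (simp add: t_def I_def nth_append)
  have part: "partition_on {1..<t + 1} (I l)" if "l \<in> {1..k}" for l
    using service_pattern_revealed[OF hd, of t] that by (auto simp: service_pattern_def t_def I_def)
  have sub: "J \<subseteq> {1..<t + 1}" if "l \<in> {1..k}" "J \<in> I l" for l J
    using part[OF that(1)] that(2) by (auto simp: partition_on_def)
  have part': "partition_on {1..<Suc t + 1} (extension (snd r) (Suc t) I l)" if "l \<in> {1..k}" for l
    using service_pattern_revealed[of "\<rho> @ [r]" k "Suc t"] snoc.prems(2) that rev
    by (auto simp: service_pattern_def t_def)
  define g' where "g' l J = (if Suc t \<in> J then f' l else g l J)" for l J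
  have "feasible_labeling k (Suc t) (extension (snd r) (Suc t) I) (\<lambda>s. fst ((\<rho> @ [r]) ! (s - 1))) g'"
    unfolding feasible_labeling_def
  proof
    fix s assume s: "s \<in> {1..Suc t}"
    show "\<exists>l\<in>{1..k}. \<exists>J\<in>extension (snd r) (Suc t) I l. s \<in> J \<and> g' l J = fst ((\<rho> @ [r]) ! (s - 1))"
    proof (cases "s = Suc t")
      case True
      from srv obtain l where l: "l \<in> {1..k}" "fst r = f' l" by auto
      have "Suc t \<in> \<Union> (extension (snd r) (Suc t) I l)"
        using part'[OF l(1)] by (auto simp: partition_on_def)
      then show ?thesis using l True by (force simp: g'_def t_def)
    next
      case False
      then have "s \<in> {1..t}" using s by auto
      then obtain l J where lJ: "l \<in> {1..k}" "J \<in> I l" "s \<in> J" "g l J = fst (\<rho> ! (s - 1))"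
        using g(1) unfolding feasible_labeling_def by blast
      have eq: "(\<rho> @ [r]) ! (s - 1) = \<rho> ! (s - 1)"
        using \<open>s \<in> {1..t}\<close> by (auto simp: nth_append t_def)
      have nin: "Suc t \<notin> J" using sub[OF lJ(1,2)] by auto
      \<comment> \<open>\<open>J'\<close> is what \<open>J\<close> becomes. If it grows, then
        \<open>l\<close> lies above \<open>snd r\<close>, so \<open>f'\<close> and \<open>f1\<close>
        agree on \<open>l\<close> and the label survives.\<close>
      define J' where "J' = (if l \<le> snd r then J else if t \<in> J then J \<union> {Suc t..<Suc t + 1} else J)"
      have "J' \<in> extension (snd r) (Suc t) I l"
        using lJ(2) by (auto simp: J'_def extension_def)
      moreover have "s \<in> J'" using lJ(3) by (simp add: J'_def)
      moreover have "g' l J' = g l J"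
        using nin g(2)[OF lJ(1,2)] keep[of l] by (auto simp: g'_def J'_def)
      ultimately show ?thesis using lJ(1,4) eq by auto
    qed
  qed
  then show ?case
    unfolding t_def[symmetric] length_append_singleton rev
    by (intro exI[of _ g'] conjI ballI impI) (simp_all add: g'_def[abs_def])
qed

text \<open>A prefix of a run of configurations is again a run, so one run for the whole input
  yields feasibility after every round.\<close>

lemma valid_inputI:
  assumes serv: "serves k f \<rho> f'" and first: "\<rho> \<noteq> [] \<Longrightarrow> snd (hd \<rho>) = k"
    and rng: "\<And>r. r \<in> set \<rho> \<Longrightarrow> fst r \<in> U \<and> snd r \<le> k"
  shows "valid_input k U \<rho>"
  unfolding valid_input_def
proof
  fix t assume t: "t \<in> {1..length \<rho>}"
  define \<rho>' where "\<rho>' = take t \<rho>"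
  have len: "length \<rho>' = t" using t by (simp add: \<rho>'_def)
  have nth: "\<rho>' ! i = \<rho> ! i" if "i < t" for i
    using that by (simp add: \<rho>'_def)
  have eq: "revealed_pattern \<rho>' t = revealed_pattern \<rho> t"
    by (rule revealed_pattern_cong) (simp add: nth)
  from serv obtain f1 where f1: "serves k f \<rho>' f1"
    unfolding \<rho>'_def by (metis append_take_drop_id serves_append)
  have hd': "\<rho>' \<noteq> [] \<Longrightarrow> snd (hd \<rho>') = k"
    using first t by (auto simp: \<rho>'_def hd_take)
  from serves_labeling[OF f1 hd'] obtain g
    where "feasible_labeling k t (revealed_pattern \<rho> t) (\<lambda>s. fst (\<rho>' ! (s - 1))) g"
    by (auto simp: len eq)
  then have g: "feasible_labeling k t (revealed_pattern \<rho> t) (\<lambda>s. fst (\<rho> ! (s - 1))) g"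
  proof -
    have "fst (\<rho>' ! (s - 1)) = fst (\<rho> ! (s - 1))" if "s \<in> {1..t}" for s
      using that by (subst nth) auto
    with \<open>feasible_labeling k t _ _ g\<close> show ?thesis
      unfolding feasible_labeling_def by metis
  qed
  have el: "\<rho> ! i \<in> set \<rho>" if "i < t" for i using that t by auto
  have r: "fst (\<rho> ! (s - 1)) \<in> U" "snd (\<rho> ! (s - 1)) \<le> k" if "s \<in> {1..t}" for s
    using rng[OF el[of "s - 1"]] that by auto
  \<comment> \<open>\<open>serves\<close> does not confine labels to \<open>U\<close>. A label
    outside \<open>U\<close> matches no request, so any point of \<open>U\<close> may replace
    it.\<close>
  define g' where "g' l J = (if g l J \<in> U then g l J else fst (\<rho> ! (t - 1)))" for l J
  have "labeling k U (revealed_pattern \<rho> t) g'"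
    using r[of t] t by (auto simp: labeling_def g'_def)
  moreover have "feasible_labeling k t (revealed_pattern \<rho> t) (\<lambda>s. fst (\<rho> ! (s - 1))) g'"
    unfolding feasible_labeling_def
  proof
    fix s assume s: "s \<in> {1..t}"
    then obtain l J where "l \<in> {1..k}" "J \<in> revealed_pattern \<rho> t l" "s \<in> J"
        "g l J = fst (\<rho> ! (s - 1))"
      using g unfolding feasible_labeling_def by blast
    then show "\<exists>l\<in>{1..k}. \<exists>J\<in>revealed_pattern \<rho> t l. s \<in> J \<and> g' l J = fst (\<rho> ! (s - 1))"
      using r(1)[OF s] by (intro bexI[of _ l] bexI[of _ J]) (auto simp: g'_def)
  qed
  moreover have "service_pattern k t (revealed_pattern \<rho> t)"
    using service_pattern_revealed[OF first] t by auto
  ultimately show "fst (\<rho> ! (t - 1)) \<in> U \<and> snd (\<rho> ! (t - 1)) \<le> k \<and>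
        service_pattern k t (revealed_pattern \<rho> t) \<and>
        feasible_pattern k U t (revealed_pattern \<rho> t) (\<lambda>s. fst (\<rho> ! (s - 1)))"
    using r[of t] t unfolding feasible_pattern_def by auto
qed

section \<open>An additive bound on the pattern cost\<close>

definition reveal_cost :: "(nat \<Rightarrow> real) \<Rightarrow> 'p input \<Rightarrow> real" where
  "reveal_cost w s = (\<Sum>r\<leftarrow>s. \<Sum>l = 1..snd r. w l)"

lemma reveal_cost_simps [simp]:
  "reveal_cost w [] = 0"
  "reveal_cost w (s @ t) = reveal_cost w s + reveal_cost w t"
  by (simp_all add: reveal_cost_def)

lemma pattern_cost_extension:
  assumes fin: "\<And>i. i \<in> {1..k} \<Longrightarrow> finite (I i)" and "l \<le> k" and w: "\<And>i. i \<in> {1..k} \<Longrightarrow> 0 \<le> w i"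
  shows "pattern_cost k w (extension l t I) \<le> pattern_cost k w I + (\<Sum>i = 1..l. w i)"
proof -
  have "w i * real (card (extension l t I i)) \<le> w i * real (card (I i)) + (if i \<le> l then w i else 0)"
    if i: "i \<in> {1..k}" for i
  proof (cases "i \<le> l")
    case True
    then have "card (extension l t I i) \<le> card (I i) + 1"
      using fin[OF i] by (auto simp: extension_def card_insert_if)
    then have "real (card (extension l t I i)) \<le> real (card (I i)) + 1" by linarith
    from mult_left_mono[OF this w[OF i]] True show ?thesis by (simp add: algebra_simps)
  next
    case False
    then have "card (extension l t I i) \<le> card (I i)"
      unfolding extension_def using card_image_le[OF fin[OF i]] by (simp only: if_False)
    then show ?thesis using False w[OF i] by (auto intro: mult_left_mono)
  qed
  then have "pattern_cost k w (extension l t I) \<le>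
      pattern_cost k w I + (\<Sum>i = 1..k. if i \<le> l then w i else 0)"
    unfolding pattern_cost_def sum.distrib[symmetric] by (rule sum_mono)
  also have "(\<Sum>i = 1..k. if i \<le> l then w i else 0) = (\<Sum>i = 1..l. w i)"
    using \<open>l \<le> k\<close> by (intro sum.mono_neutral_cong_right) auto
  finally show ?thesis .
qed

text \<open>Each round is charged one new interval on every level up to its own. Unlike the pattern
  cost, this charge is additive under concatenation.\<close>

lemma pattern_cost_revealed:
  assumes "valid_input k U \<rho>" and w: "\<And>i. i \<in> {1..k} \<Longrightarrow> 0 \<le> w i"
  shows "pattern_cost k w (revealed_pattern \<rho> (length \<rho>)) \<le> reveal_cost w \<rho>"
  using assms(1)
proof (induction \<rho> rule: rev_induct)
  case Nil
  then show ?case by (simp add: pattern_cost_def)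
next
  case (snoc r \<rho>)
  let ?t = "length \<rho>"
  let ?I = "revealed_pattern \<rho> ?t"
  have v: "valid_input k U \<rho>" by (rule valid_input_append[OF snoc.prems])
  have rev: "revealed_pattern (\<rho> @ [r]) (Suc ?t) = extension (snd r) (Suc ?t) ?I"
    using revealed_pattern_cong[of ?t "\<rho> @ [r]" \<rho>] by (simp add: nth_append)
  have "finite (?I i)" if "i \<in> {1..k}" for i
  proof (cases "\<rho> = []")
    case False
    then have "service_pattern k ?t ?I" using v by (auto simp: valid_input_def Suc_le_eq)
    then show ?thesis using that finite_elements[of "{1..<?t + 1}"]
      by (auto simp: service_pattern_def)
  qed simp
  moreover have "snd r \<le> k"
    using snoc.prems by (force simp: valid_input_def dest: bspec[of _ _ "Suc ?t"])
  ultimately have "pattern_cost k w (extension (snd r) (Suc ?t) ?I) \<le>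
      pattern_cost k w ?I + (\<Sum>i = 1..snd r. w i)"
    using w by (intro pattern_cost_extension) auto
  also have "\<dots> \<le> reveal_cost w \<rho> + (\<Sum>i = 1..snd r. w i)"
    using snoc.IH[OF v] by simp
  finally show ?case using rev by (simp add: reveal_cost_def)
qed

section \<open>Attacks\<close>

definition covering :: "nat \<Rightarrow> 'p set \<Rightarrow> 'p set set \<Rightarrow> bool" where
  "covering n P \<Q> \<longleftrightarrow>
     finite \<Q> \<and> card \<Q> \<le> n + 1 \<and> (\<forall>Q\<in>\<Q>. Q \<subseteq> P \<and> card Q = n) \<and>
     (\<forall>x. \<exists>Q\<in>\<Q>. x \<notin> Q) \<and> (\<forall>p\<in>P. \<exists>q\<in>P. \<forall>Q\<in>\<Q>. p \<in> Q \<or> q \<in> Q)"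

text \<open>
  The points are arranged in a grid. The \<open>i\<close>-th set of the covering consists of row \<open>i\<close> without
  its head \<open>(i, 0)\<close> and of the heads of all other rows.
\<close>

lemma covering_exists:
  fixes P :: "'p set"
  assumes n: "n \<ge> 1" and card: "card P = (n - n div 2 + 1) * (n div 2 + 1)"
  shows "\<exists>\<Q>. covering n P \<Q>"
proof -
  \<comment> \<open>With \<open>a\<close> rows and \<open>b\<close> columns, a set of the covering
    has \<open>(b - 1) + (a - 1) = n\<close> points; nearly equal sides maximize the grid.\<close>
  define a where "a = n - n div 2 + 1"
  define b where "b = n div 2 + 1"
  have ab: "a + b = n + 2" "a \<ge> 2" "b \<ge> 1" "a \<le> n + 1"
    using n by (auto simp: a_def b_def)
  have "finite P" using card by (metis card.infinite add_is_0 mult_is_0 one_neq_zero)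
  moreover have "card ({..<a} \<times> {..<b}) = card P" using card by (simp add: a_def b_def)
  ultimately obtain e where e: "bij_betw e ({..<a} \<times> {..<b}) P"
    using finite_same_card_bij by (metis finite_SigmaI finite_lessThan)
  define R where "R i = {i} \<times> {1..<b} \<union> ({..<a} - {i}) \<times> {0}" for i :: nat
  have R_sub: "R i \<subseteq> {..<a} \<times> {..<b}" if "i < a" for i
    using that ab by (auto simp: R_def)
  have inj: "inj_on e ({..<a} \<times> {..<b})" using e by (rule bij_betw_imp_inj_on)
  have e_in: "e z \<in> e ` R i \<longleftrightarrow> z \<in> R i" if "z \<in> {..<a} \<times> {..<b}" "i < a" for z i
    using inj_on_image_mem_iff[OF inj that(1) R_sub[OF that(2)]] .
  have e_P: "e z \<in> P" if "z \<in> {..<a} \<times> {..<b}" for z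
    using e that by (auto simp: bij_betw_def)
  have P_e: "\<exists>i j. i < a \<and> j < b \<and> p = e (i, j)" if "p \<in> P" for p
    using e that by (auto simp: bij_betw_def)
  have card_R: "card (e ` R i) = n" if i: "i < a" for i
  proof -
    have "card (e ` R i) = card (R i)"
      by (rule card_image[OF inj_on_subset[OF inj R_sub[OF i]]])
    also have "\<dots> = (b - 1) + (a - 1)"
      unfolding R_def using i by (subst card_Un_disjoint) (auto simp: card_cartesian_product)
    finally show ?thesis using ab by simp
  qed
  have sub: "e ` R i \<subseteq> P" if "i < a" for i
    using R_sub[OF that] e_P by auto
  have other: "\<exists>i'<a. i' \<noteq> i" for i
  proof (cases "i = 0")
    case True then show ?thesis using ab by (intro exI[of _ 1]) auto
  next
    case False then show ?thesis using ab by (intro exI[of _ 0]) auto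
  qed
  have miss: "\<exists>i<a. x \<notin> e ` R i" for x
  proof (cases "x \<in> P")
    case False
    then show ?thesis using sub[of 0] ab by (intro exI[of _ 0]) auto
  next
    case True
    then obtain i j where ij: "i < a" "j < b" "x = e (i, j)" using P_e by blast
    obtain i' where i': "i' < a" "i' \<noteq> i" using other by blast
    \<comment> \<open>A head is missed by the set of its own row, any other point by the sets of all
      other rows.\<close>
    show ?thesis
    proof (cases "j = 0")
      case True
      then have "x \<notin> e ` R i" using ij by (simp add: e_in) (simp add: R_def)
      then show ?thesis using ij by blast
    next
      case False
      then have "x \<notin> e ` R i'" using ij i' by (simp add: e_in) (simp add: R_def)
      then show ?thesis using i' by blast
    qed
  qed
  have pair: "\<exists>q\<in>P. \<forall>i<a. p \<in> e ` R i \<or> q \<in> e ` R i" if "p \<in> P" for p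
  proof -
    obtain i j where ij: "i < a" "j < b" "p = e (i, j)" using P_e \<open>p \<in> P\<close> by blast
    obtain i' where i': "i' < a" "i' \<noteq> i" using other by blast
    \<comment> \<open>Two heads are companions because each set misses only one head. A non-head is
      paired with the head of its row: set \<open>i\<close> contains the former, all other sets the
      latter.\<close>
    define q where "q = (if j = 0 then (i', 0) else (i, 0::nat))"
    have q: "q \<in> {..<a} \<times> {..<b}" using ij i' ab by (auto simp: q_def)
    have "p \<in> e ` R i'' \<or> e q \<in> e ` R i''" if "i'' < a" for i''
      using ij i' q that ab by (simp add: e_in) (auto simp: R_def q_def)
    then show ?thesis using e_P[OF q] by blast
  qed
  let ?\<Q> = "(\<lambda>i. e ` R i) ` {..<a}"
  have "card ?\<Q> \<le> n + 1"
    using card_image_le[of "{..<a}" "\<lambda>i. e ` R i"] ab by simp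
  moreover have "\<exists>Q\<in>?\<Q>. x \<notin> Q" for x
    using miss[of x] by blast
  moreover have "\<exists>q\<in>P. \<forall>Q\<in>?\<Q>. p \<in> Q \<or> q \<in> Q" if p: "p \<in> P" for p
  proof -
    obtain q where "q \<in> P" "\<forall>i<a. p \<in> e ` R i \<or> q \<in> e ` R i" using pair[OF p] by blast
    then show ?thesis by (intro bexI[of _ q]) simp_all
  qed
  ultimately have "covering n P ?\<Q>"
    unfolding covering_def using card_R sub by simp
  then show ?thesis ..
qed

section \<open>Sizes of the attacked sets\<close>

primrec pts :: "nat \<Rightarrow> nat" where
  "pts 0 = 1"
| "pts (Suc l) = (pts l - pts l div 2 + 1) * (pts l div 2 + 1)"

lemma pts_pos: "1 \<le> pts l"
  by (induction l) auto

text \<open>The product is at least \<open>n ^ 2 / 4\<close>, so \<open>pts l / 4\<close> at least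
  squares in each step. The offset 3 is the first level where \<open>pts\<close> reaches 8.\<close>

lemma pts_growth: "4 * 2 ^ 2 ^ l \<le> pts (l + 3)"
proof (induction l)
  case 0
  have "pts 3 = 9" by (simp add: numeral_3_eq_3)
  then show ?case by simp
next
  case (Suc l)
  define n where "n = pts (l + 3)"
  obtain m where m: "n = 2 * m \<or> n = 2 * m + 1" by (metis evenE oddE)
  have "n ^ 2 \<le> 4 * ((n - n div 2 + 1) * (n div 2 + 1))"
    using m by (auto simp: power2_eq_square algebra_simps)
  moreover have "pts (Suc l + 3) = (n - n div 2 + 1) * (n div 2 + 1)"
    by (simp only: add_Suc pts.simps n_def)
  ultimately have "n ^ 2 \<le> 4 * pts (Suc l + 3)" by (simp only:)
  moreover have "(4 * 2 ^ 2 ^ l) ^ 2 \<le> n ^ 2"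
    using Suc.IH unfolding n_def by (rule power_mono) simp
  moreover have "(4 * 2 ^ 2 ^ l) ^ 2 = 4 * (4 * 2 ^ 2 ^ Suc l :: nat)"
    by (simp add: power2_eq_square mult_2 power_add)
  ultimately show ?case by linarith
qed

definition family :: "nat \<Rightarrow> 'p set \<Rightarrow> 'p set set" where
  "family n P = (SOME \<Q>. covering n P \<Q>)"

lemma covering_family:
  assumes "card P = pts (Suc l)"
  shows "covering (pts l) P (family (pts l) P)"
  unfolding family_def
  by (rule someI_ex, rule covering_exists) (use assms pts_pos in auto)

text \<open>The first segment has a set of its own because only the first round of an attack may
  start intervals on levels as high as \<open>l'\<close>.\<close>

primrec runs :: "'a list set \<Rightarrow> 'a list set \<Rightarrow> nat \<Rightarrow> 'a list set" where
  "runs S\<^sub>0 S 0 = {[]}"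
| "runs S\<^sub>0 S (Suc r) = {t @ s |t s. t \<in> runs S\<^sub>0 S r \<and> s \<in> (if r = 0 then S\<^sub>0 else S)}"

lemma runs_nonempty:
  assumes "S\<^sub>0 \<noteq> {}" "S \<noteq> {}"
  shows "runs S\<^sub>0 S r \<noteq> {}"
proof (induction r)
  case (Suc r)
  have "(if r = 0 then S\<^sub>0 else S) \<noteq> {}" using assms by simp
  with Suc show ?case by fastforce
qed simp

text \<open>Lets partial runs inherit validity from complete attacks.\<close>

lemma runs_extend:
  assumes "S\<^sub>0 \<noteq> {}" "S \<noteq> {}" "r \<le> r'" "t \<in> runs S\<^sub>0 S r"
  shows "\<exists>u. t @ u \<in> runs S\<^sub>0 S r'"
  using assms(3)
proof (induction r' rule: dec_induct)
  case base
  then show ?case using assms(4) by (intro exI[of _ "[]"]) simp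
next
  case (step r')
  then obtain u where u: "t @ u \<in> runs S\<^sub>0 S r'" by blast
  have "(if r' = 0 then S\<^sub>0 else S) \<noteq> {}" using assms by simp
  then obtain s where "s \<in> (if r' = 0 then S\<^sub>0 else S)" by blast
  with u have "(t @ u) @ s \<in> runs S\<^sub>0 S (Suc r')" unfolding runs.simps by blast
  then show ?case by (metis append_assoc)
qed

lemma runs_set:
  "t \<in> runs S\<^sub>0 S r \<Longrightarrow> x \<in> set t \<Longrightarrow> \<exists>s\<in>S\<^sub>0 \<union> S. x \<in> set s"
proof (induction r arbitrary: t)
  case (Suc r)
  then obtain u s where "t = u @ s" "u \<in> runs S\<^sub>0 S r" "s \<in> S\<^sub>0 \<union> S"
    by (auto split: if_splits)
  then show ?case using Suc by auto
qed simp

lemma runs_hd: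
  assumes "\<And>s. s \<in> S\<^sub>0 \<Longrightarrow> s \<noteq> [] \<and> h (hd s)" "t \<in> runs S\<^sub>0 S (Suc r)"
  shows "t \<noteq> [] \<and> h (hd t)"
  using assms(2)
proof (induction r arbitrary: t)
  case 0
  then show ?case using assms(1) by auto
next
  case (Suc r)
  then obtain u s where "t = u @ s" "u \<in> runs S\<^sub>0 S (Suc r)"
    unfolding runs.simps(2)[of _ _ "Suc r"] by auto
  then show ?case using Suc.IH[of u] by simp
qed

text \<open>
  The levels up to \<open>l'\<close> start a new interval in the first round. The number of segments is such that
  hits of probability \<open>1 / (pts l + 1)\<close> and expected cost \<open>D\<^sup>l\<^sup>+\<^sup>1 / 2\<close> add up to
  \<open>D\<^sup>l\<^sup>+\<^sup>2\<close>, twice the expected cost that an attack of level \<open>l + 1\<close> has to enforce.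
\<close>

primrec attack :: "nat \<Rightarrow> nat \<Rightarrow> nat \<Rightarrow> 'p set \<Rightarrow> 'p input set" where
  "attack D 0 l' P = (\<lambda>x. [(x, l')]) ` P"
| "attack D (Suc l) l' P =
     runs (\<Union>Q\<in>family (pts l) P. attack D l l' Q) (\<Union>Q\<in>family (pts l) P. attack D l l Q)
       (2 * (pts l + 1) * D)"

lemma attack_segments_nonempty:
  fixes P :: "'p set"
  assumes "card P = pts (Suc l)" "\<And>Q :: 'p set. card Q = pts l \<Longrightarrow> attack D l l' Q \<noteq> {}"
  shows "(\<Union>Q\<in>family (pts l) P. attack D l l' Q) \<noteq> {}"
proof -
  obtain Q where Q: "Q \<in> family (pts l) P" "card Q = pts l"
    using covering_family[OF assms(1)] unfolding covering_def by blast
  show ?thesis using assms(2)[OF Q(2)] Q(1) by blast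
qed

lemma attack_nonempty: "card P = pts l \<Longrightarrow> attack D l l' P \<noteq> {}"
proof (induction l arbitrary: l' P)
  case 0
  then show ?case by auto
next
  case (Suc l)
  then show ?case
    unfolding attack.simps by (intro runs_nonempty attack_segments_nonempty) auto
qed

lemma attack_range:
  assumes "s \<in> attack D l l' P" "card P = pts l" "l \<le> l'" "r \<in> set s"
  shows "fst r \<in> P \<and> snd r \<le> l'"
  using assms
proof (induction l arbitrary: l' P s)
  case 0
  then show ?case by auto
next
  case (Suc l)
  from runs_set[OF Suc.prems(1)[unfolded attack.simps] Suc.prems(4)]
  obtain Q u l'' where Q: "Q \<in> family (pts l) P" "u \<in> attack D l l'' Q" "r \<in> set u"
    "l'' = l' \<or> l'' = l" by blast
  have "Q \<subseteq> P" "card Q = pts l"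
    using covering_family[OF Suc.prems(2)] Q(1) by (auto simp: covering_def)
  then show ?case
    using Suc.IH[OF Q(2) \<open>card Q = pts l\<close> _ Q(3)] Q(4) Suc.prems(3) by auto
qed

lemma attack_hd:
  assumes "s \<in> attack D l l' P" "D > 0"
  shows "s \<noteq> [] \<and> snd (hd s) = l'"
  using assms
proof (induction l arbitrary: l' P s)
  case 0
  then show ?case by auto
next
  case (Suc l)
  obtain r where r: "2 * (pts l + 1) * D = Suc r"
    using \<open>D > 0\<close> by (metis add_gr_0 gr0_implies_Suc mult_pos_pos pos2 zero_less_one)
  show ?case
    by (rule runs_hd[OF _ Suc.prems(1)[unfolded attack.simps r], where h = "\<lambda>x. snd x = l'"])
      (use Suc.IH \<open>D > 0\<close> in blast)
qed

text \<open>
  The configuration \<open>f\<^sub>0\<close> carries the target labels of the levels above \<open>l\<close>, to which the labels of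
  the levels up to \<open>l'\<close> may be changed in the first round.
\<close>

lemma attack_serves:
  assumes "s \<in> attack D l l' P" "card P = pts l" "l \<le> l'" "i \<in> {l + 1..k}" "f\<^sub>0 i \<in> P"
    and "\<And>j. l' < j \<Longrightarrow> f j = f\<^sub>0 j" and "D > 0"
  shows "\<exists>f'. serves k f s f' \<and> (\<forall>j>l. f' j = f\<^sub>0 j)"
  using assms
proof (induction l arbitrary: l' P s f f\<^sub>0 i)
  case 0
  from 0 obtain x where "s = [(x, l')]" "P = {x}"
    by (auto simp: card_1_singleton_iff)
  then show ?case using 0 by (intro exI[of _ f\<^sub>0]) (auto simp: image_iff)
next
  case (Suc l)
  note outer_IH = Suc.IH
  have "\<forall>p\<in>P. \<exists>q\<in>P. \<forall>Q\<in>family (pts l) P. p \<in> Q \<or> q \<in> Q"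
    and cov: "\<forall>Q\<in>family (pts l) P. Q \<subseteq> P \<and> card Q = pts l"
    using covering_family[OF Suc.prems(2)] unfolding covering_def by blast+
  from bspec[OF this(1) Suc.prems(5)]
  obtain q where q: "\<And>Q. Q \<in> family (pts l) P \<Longrightarrow> f\<^sub>0 i \<in> Q \<or> q \<in> Q" by blast
  \<comment> \<open>The companion \<open>q\<close> of the label \<open>f\<^sub>0 i\<close> becomes
    the label of level \<open>Suc l\<close>. It can be set in the first round since
    \<open>Suc l \<le> l'\<close>, and it stays because later segments restart only levels up to
    \<open>l\<close>.\<close>
  define f\<^sub>1 where "f\<^sub>1 = f\<^sub>0(Suc l := q)"
  have "\<exists>f'. serves k f t f' \<and> (\<forall>j>(if r = 0 then l' else l). f' j = f\<^sub>1 j)"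
    if "t \<in> runs (\<Union>Q\<in>family (pts l) P. attack D l l' Q) (\<Union>Q\<in>family (pts l) P. attack D l l Q) r"
    for r t
    using that
  proof (induction r arbitrary: t)
    case 0
    then show ?case using Suc.prems(3,6) by (auto simp: f\<^sub>1_def)
  next
    case (Suc r)
    let ?l = "if r = 0 then l' else l"
    from Suc.prems obtain u s Q where t: "t = u @ s"
      and u: "u \<in> runs (\<Union>Q\<in>family (pts l) P. attack D l l' Q) (\<Union>Q\<in>family (pts l) P. attack D l l Q) r"
      and s: "s \<in> attack D l ?l Q" and Q: "Q \<in> family (pts l) P"
      by (auto split: if_splits)
    from Suc.IH[OF u] obtain f' where f': "serves k f u f'" "\<And>j. ?l < j \<Longrightarrow> f' j = f\<^sub>1 j"
      by blast
    have card: "card Q = pts l" using cov Q by blast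
    have l: "l \<le> ?l" using \<open>Suc l \<le> l'\<close> by auto
    have "\<exists>i'\<in>{l + 1..k}. f\<^sub>1 i' \<in> Q"
    proof (cases "q \<in> Q")
      case True
      then show ?thesis using \<open>i \<in> {Suc l + 1..k}\<close>
        by (intro bexI[of _ "Suc l"]) (auto simp: f\<^sub>1_def)
    next
      case False
      then show ?thesis using q[OF Q] \<open>i \<in> {Suc l + 1..k}\<close>
        by (intro bexI[of _ i]) (auto simp: f\<^sub>1_def)
    qed
    then obtain i' where "i' \<in> {l + 1..k}" "f\<^sub>1 i' \<in> Q" by blast
    from outer_IH[where f = f' and f\<^sub>0 = f\<^sub>1, OF s card l this f'(2) \<open>D > 0\<close>]
    obtain f'' where "serves k f' s f''" "\<forall>j>l. f'' j = f\<^sub>1 j" by auto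
    then show ?case using f'(1) t by (auto simp: serves_append)
  qed
  from this[OF Suc.prems(1)[unfolded attack.simps]] obtain f'
    where "serves k f s f'" "\<forall>j>(if 2 * (pts l + 1) * D = 0 then l' else l). f' j = f\<^sub>1 j" by blast
  then show ?case using \<open>D > 0\<close> by (intro exI[of _ f']) (auto simp: f\<^sub>1_def)
qed

text \<open>Charge of an attack beyond its first round, in units of \<open>D ^ l\<close>. The number
  of segments is proportional to \<open>D\<close>, which the step from \<open>D ^ l\<close> to
  \<open>D ^ Suc l\<close> absorbs. The value is thus free of \<open>D\<close>, and \<open>D\<close>
  can be chosen after it.\<close>

primrec overhead :: "nat \<Rightarrow> real" where
  "overhead 0 = 0"
| "overhead (Suc l) = 2 * (real (pts l) + 1) * (2 + overhead l)"

lemma sum_powers_le: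
  fixes D :: real
  assumes "D \<ge> 2"
  shows "(\<Sum>i = 1..l. D ^ i) \<le> 2 * D ^ l"
proof (induction l)
  case (Suc l)
  have "2 * D ^ l \<le> D * D ^ l" using assms by (intro mult_right_mono) auto
  with Suc show ?case by simp
qed simp

lemma attack_cost:
  fixes P :: "'p set"
  assumes "s \<in> attack D l l' P" "D \<ge> 2"
  shows "reveal_cost (\<lambda>i. real D ^ i) s \<le> (\<Sum>i = 1..l'. real D ^ i) + overhead l * real D ^ l"
  using assms(1)
proof (induction l arbitrary: l' P s)
  case 0
  then show ?case by (auto simp: reveal_cost_def)
next
  case (Suc l)
  note outer_IH = Suc.IH
  let ?W = "\<lambda>l. \<Sum>i = 1..l. real D ^ i"
  have W: "?W l \<le> 2 * real D ^ l"
    using sum_powers_le[of "real D" l] \<open>D \<ge> 2\<close> by simp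
  \<comment> \<open>The summand 2 pays for the first round of a segment, which starts levels up to
    \<open>l\<close>. The very first round starts levels up to \<open>l'\<close> and is accounted
    for separately.\<close>
  have "reveal_cost (\<lambda>i. real D ^ i) t \<le>
      (if r = 0 then 0 else ?W l') + real r * ((2 + overhead l) * real D ^ l)"
    if "t \<in> runs (\<Union>Q\<in>family (pts l) P. attack D l l' Q) (\<Union>Q\<in>family (pts l) P. attack D l l Q) r"
    for r t
    using that
  proof (induction r arbitrary: t)
    case (Suc r)
    let ?l = "if r = 0 then l' else l"
    from Suc.prems obtain u s Q where t: "t = u @ s"
      and u: "u \<in> runs (\<Union>Q\<in>family (pts l) P. attack D l l' Q) (\<Union>Q\<in>family (pts l) P. attack D l l Q) r"
      and s: "s \<in> attack D l ?l Q" and Q: "Q \<in> family (pts l) P"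
      by (auto split: if_splits)
    have pos: "0 \<le> real D ^ l" by simp
    show ?case
    proof (cases "r = 0")
      case True
      then have "reveal_cost (\<lambda>i. real D ^ i) t \<le> ?W l' + overhead l * real D ^ l"
        using Suc.IH[OF u] outer_IH[OF s] by (simp add: t)
      also have "\<dots> \<le> ?W l' + (2 + overhead l) * real D ^ l"
        using pos by (simp add: distrib_right)
      finally show ?thesis using True by simp
    next
      case False
      then show ?thesis
        using Suc.IH[OF u] outer_IH[OF s] W by (simp add: t algebra_simps)
    qed
  qed simp
  from this[OF Suc.prems[unfolded attack.simps]] 
  have "reveal_cost (\<lambda>i. real D ^ i) s \<le>
      ?W l' + real (2 * (pts l + 1) * D) * ((2 + overhead l) * real D ^ l)"
    using \<open>D \<ge> 2\<close> by simp
  then show ?case by (simp add: algebra_simps)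
qed

section \<open>The expected cost of an algorithm\<close>

lemma moves_snoc:
  "moves A (\<rho> @ [r]) i = moves A \<rho> i + of_bool (A (\<rho> @ [r]) i \<noteq> A \<rho> i)"
proof -
  let ?n = "length \<rho>"
  have "{t \<in> {1..length (\<rho> @ [r])}. A (take t (\<rho> @ [r])) i \<noteq> A (take (t - 1) (\<rho> @ [r])) i} =
      {t \<in> {1..?n}. A (take t \<rho>) i \<noteq> A (take (t - 1) \<rho>) i} \<union>
      (if A (\<rho> @ [r]) i \<noteq> A \<rho> i then {Suc ?n} else {})"
    by (auto simp: le_Suc_eq)
  then show ?thesis
    unfolding moves_def by (simp add: card_insert_if)
qed

lemma algorithm_cost_snoc:
  "algorithm_cost k w A (\<rho> @ [r]) =
     algorithm_cost k w A \<rho> + (\<Sum>i = 1..k. w i * of_bool (A (\<rho> @ [r]) i \<noteq> A \<rho> i))"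
  unfolding algorithm_cost_def
  by (simp add: moves_snoc sum.distrib distrib_left)

lemma moves_append:
  "moves A \<rho> i + of_bool (A (\<rho> @ s) i \<noteq> A \<rho> i) \<le> moves A (\<rho> @ s) i"
proof (induction s rule: rev_induct)
  case (snoc r s)
  then show ?case using moves_snoc[of A "\<rho> @ s" r i] by (auto simp: of_bool_def split: if_splits)
qed simp

lemma algorithm_cost_mono:
  assumes "\<And>i. i \<in> {1..k} \<Longrightarrow> 0 \<le> w i"
  shows "algorithm_cost k w A \<rho> \<le> algorithm_cost k w A (\<rho> @ s)"
  unfolding algorithm_cost_def
proof (intro sum_mono mult_left_mono)
  fix i show "real (moves A \<rho> i) \<le> real (moves A (\<rho> @ s) i)"
    using moves_append[of A \<rho> i s] by simp
qed (use assms in auto)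

lemma algorithm_cost_move:
  assumes w: "\<And>i. i \<in> {1..k} \<Longrightarrow> 0 \<le> w i" and i: "i \<in> {1..k}" "A (\<rho> @ s) i \<noteq> A \<rho> i"
  shows "algorithm_cost k w A \<rho> + w i \<le> algorithm_cost k w A (\<rho> @ s)"
proof -
  have "algorithm_cost k w A \<rho> + w i = (\<Sum>j = 1..k. w j * real (moves A \<rho> j) + (if j = i then w j else 0))"
    using i(1) by (simp add: algorithm_cost_def sum.distrib)
  also have "\<dots> \<le> algorithm_cost k w A (\<rho> @ s)"
    unfolding algorithm_cost_def
  proof (rule sum_mono)
    fix j assume j: "j \<in> {1..k}"
    have "real (moves A \<rho> j) + (if j = i then 1 else 0) \<le> real (moves A (\<rho> @ s) j)"
      using moves_append[of A \<rho> j s] i(2) by (auto simp: of_bool_def split: if_splits)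
    from mult_left_mono[OF this w[OF j]]
    show "w j * real (moves A \<rho> j) + (if j = i then w j else 0) \<le> w j * real (moves A (\<rho> @ s) j)"
      by (simp add: distrib_left split: if_splits)
  qed
  finally show ?thesis .
qed

section \<open>Expected cost restricted to events\<close>

locale randomized =
  fixes k D :: nat and U :: "nat set" and M :: "nat algorithm measure"
  assumes rand: "randomized_algorithm k U M" and D: "D \<ge> 2"
begin

sublocale prob_space M
  using rand by (simp add: randomized_algorithm_def)

abbreviation w :: "nat \<Rightarrow> real" where
  "w i \<equiv> real D ^ i"

abbreviation C :: "nat algorithm \<Rightarrow> nat input \<Rightarrow> real" where
  "C \<equiv> algorithm_cost k w"

lemma w_mono: "i \<le> j \<Longrightarrow> w i \<le> w j"
  using D by (intro power_increasing) auto

lemma measurable_position: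
  assumes "valid_input k U \<rho>" "i \<in> {1..k}"
  shows "(\<lambda>A. A \<rho> i) \<in> measurable M (count_space UNIV)"
  using rand assms unfolding randomized_algorithm_def by blast

lemma sets_position:
  assumes "valid_input k U \<rho>" "i \<in> {1..k}"
  shows "{A \<in> space M. A \<rho> i \<in> X} \<in> sets M"
  using measurable_sets[OF measurable_position[OF assms], of X]
  by (simp add: vimage_def Int_def conj_commute)

lemma sets_move:
  assumes "valid_input k U \<rho>" "valid_input k U \<rho>'" "i \<in> {1..k}"
  shows "{A \<in> space M. A \<rho> i \<noteq> A \<rho>' i} \<in> sets M"
proof -
  \<comment> \<open>Points are natural numbers, so the event splits into countably many measurable
    ones.\<close>
  have "{A \<in> space M. A \<rho> i \<noteq> A \<rho>' i} =
      (\<Union>n. {A \<in> space M. A \<rho> i \<in> {n}} \<inter> {A \<in> space M. A \<rho>' i \<in> - {n}})"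
    by auto
  also have "\<dots> \<in> sets M"
    using assms by (intro sets.countable_UN sets.Int image_subsetI sets_position)
  finally show ?thesis .
qed

text \<open>For a fixed input the cost is a finite combination of indicators. Integrability rules
  out the default value 0 of the integral.\<close>

lemma integrable_cost:
  assumes "valid_input k U \<rho>"
  shows "integrable M (\<lambda>A. C A \<rho>)"
  using assms
proof (induction \<rho> rule: rev_induct)
  case Nil
  then show ?case by (simp add: algorithm_cost_def moves_def)
next
  case (snoc r \<rho>)
  have v: "valid_input k U \<rho>" by (rule valid_input_append[OF snoc.prems])
  have "integrable M (\<lambda>A. w i * of_bool (A (\<rho> @ [r]) i \<noteq> A \<rho> i))" if i: "i \<in> {1..k}" for i
  proof -
    let ?B = "{A \<in> space M. A (\<rho> @ [r]) i \<noteq> A \<rho> i}"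
    have "integrable M (indicator ?B :: _ \<Rightarrow> real)"
      using sets_move[OF snoc.prems v i] by (simp add: less_top[symmetric])
    then have "integrable M (\<lambda>A. of_bool (A (\<rho> @ [r]) i \<noteq> A \<rho> i) :: real)"
      by (rule Bochner_Integration.integrable_cong[THEN iffD1, rotated 2])
        (auto simp: indicator_def)
    then show ?thesis by (rule integrable_mult_right)
  qed
  then show ?case
    unfolding algorithm_cost_snoc
    by (intro Bochner_Integration.integrable_add Bochner_Integration.integrable_sum snoc.IH[OF v]) 
qed

text \<open>Restricting by an indicator instead of conditioning makes the gain monotone in
  \<open>G\<close> and avoids a special case for null events.\<close>

definition gain :: "nat algorithm set \<Rightarrow> nat input \<Rightarrow> nat input \<Rightarrow> real" where
  "gain G \<rho> s = (\<integral>A. indicator G A * (C A (\<rho> @ s) - C A \<rho>) \<partial>M)"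

lemma integrable_gain:
  assumes "valid_input k U (\<rho> @ s)" "G \<in> sets M"
  shows "integrable M (\<lambda>A. indicator G A * (C A (\<rho> @ s) - C A \<rho>))"
  using integrable_cost[OF assms(1)] integrable_cost[OF valid_input_append[OF assms(1)]] assms(2)
  by (intro integrable_real_mult_indicator[of G M, unfolded mult.commute[of _ "indicator _ _"]]) auto

lemma gain_Nil [simp]: "gain G \<rho> [] = 0"
  by (simp add: gain_def)

lemma gain_append:
  assumes "valid_input k U (\<rho> @ s @ t)" "G \<in> sets M"
  shows "gain G \<rho> (s @ t) = gain G \<rho> s + gain G (\<rho> @ s) t"
proof -
  have "valid_input k U ((\<rho> @ s) @ t)" using assms by simp
  from integrable_gain[OF this assms(2)] integrable_gain[OF valid_input_append[OF this] assms(2)]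
  show ?thesis
    unfolding gain_def
    by (subst Bochner_Integration.integral_add[symmetric]) (auto simp: algebra_simps)
qed

lemma cost_mono: "C A \<rho> \<le> C A (\<rho> @ s)"
  by (rule algorithm_cost_mono) simp

lemma gain_mono:
  assumes "valid_input k U (\<rho> @ s)" "G \<in> sets M" "H \<in> sets M" "H \<subseteq> G"
  shows "gain H \<rho> s \<le> gain G \<rho> s"
  unfolding gain_def
  using assms by (intro integral_mono integrable_gain mult_right_mono)
    (auto simp: indicator_def cost_mono)

lemma gain_ge:
  assumes v: "valid_input k U (\<rho> @ s)" and G: "G \<in> sets M" and H: "H \<in> sets M" "H \<subseteq> G"
    and c: "\<And>A. A \<in> H \<Longrightarrow> C A \<rho> + c \<le> C A (\<rho> @ s)"
  shows "measure M H * c \<le> gain G \<rho> s"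
proof -
  have "measure M H * c = (\<integral>A. indicator H A * c \<partial>M)"
    using H(1) sets.Int_space_eq2[OF H(1)] by simp
  also have "\<dots> \<le> gain H \<rho> s"
    unfolding gain_def
  proof (rule integral_mono[OF _ integrable_gain[OF v H(1)]])
    show "integrable M (\<lambda>A. indicator H A * c)"
      using H(1) by (intro integrable_mult_left) (simp add: less_top[symmetric])
    fix A show "indicator H A * c \<le> indicator H A * (C A (\<rho> @ s) - C A \<rho>)"
      using c[of A] by (auto simp: indicator_def)
  qed
  also have "\<dots> \<le> gain G \<rho> s" by (rule gain_mono[OF v G H])
  finally show ?thesis .
qed

lemma gain_nonneg:
  assumes "valid_input k U (\<rho> @ s)" "G \<in> sets M"
  shows "0 \<le> gain G \<rho> s"
  using gain_ge[OF assms, of "{}" 0] by simp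

text \<open>Union bound; it lets the adversary choose the most frequently missed set
  deterministically.\<close>

lemma exists_large_part:
  assumes fin: "finite I" "card I \<le> n" and G: "G \<in> sets M" and F: "\<And>i. i \<in> I \<Longrightarrow> F i \<in> sets M"
    and cov: "G \<subseteq> (\<Union>i\<in>I. F i)" and n: "n > 0" and ne: "I \<noteq> {}"
  shows "\<exists>i\<in>I. measure M G / real n \<le> measure M (F i)"
proof (rule ccontr)
  assume "\<not> ?thesis"
  then have less: "measure M (F i) < measure M G / real n" if "i \<in> I" for i
    using that by (meson linorder_not_le)
  have "measure M G \<le> measure M (\<Union>i\<in>I. F i)"
    using F fin cov by (intro finite_measure_mono) auto
  also have "\<dots> \<le> (\<Sum>i\<in>I. measure M (F i))"
    using F fin by (intro finite_measure_subadditive_finite) auto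
  also have "\<dots> < (\<Sum>i\<in>I. measure M G / real n)"
    using less fin ne by (intro sum_strict_mono) auto
  also have "\<dots> \<le> real n * (measure M G / real n)"
    using fin n by (simp only: sum_constant) (intro mult_right_mono, auto)
  finally show False using n by simp
qed

text \<open>
  In the induction step, either the servers above \<open>Suc l\<close> have entered \<open>P\<close> on half of \<open>G\<close>, which
  has cost enough, or the next segment hits server \<open>Suc l\<close> on a fraction of the other half.
\<close>

lemma attack_gain:
  assumes "l < k" "card P = pts l" "l \<le> l'" "\<And>s. s \<in> attack D l l' P \<Longrightarrow> valid_input k U (\<rho> @ s)"
    and "G \<in> sets M" "\<And>A i. A \<in> G \<Longrightarrow> i \<in> {l + 1..k} \<Longrightarrow> A \<rho> i \<notin> P"
  shows "\<exists>s\<in>attack D l l' P. measure M G * w (l + 1) / 2 \<le> gain G \<rho> s"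
  using assms
proof (induction l arbitrary: l' P \<rho> G)
  case 0
  \<comment> \<open>No server at all is at \<open>x\<close>, since the hypothesis covers all levels
    from 1 on. So one must move there, at cost at least \<open>w 1\<close>.\<close>
  then obtain x where P: "P = {x}" by (auto simp: card_1_singleton_iff)
  let ?s = "[(x, l')]"
  have v: "valid_input k U (\<rho> @ ?s)" using 0 P by simp
  have "C A \<rho> + w 1 \<le> C A (\<rho> @ ?s)" if A: "A \<in> G" for A
  proof -
    have "A \<in> space M" using A 0 sets.sets_into_space by blast
    then have "online_algorithm k U A" using rand by (simp add: randomized_algorithm_def)
    then obtain i where i: "i \<in> {1..k}" "A (\<rho> @ ?s) i = x"
      using v unfolding online_algorithm_def by fastforce
    then have "A (\<rho> @ ?s) i \<noteq> A \<rho> i" using 0(6)[OF A, of i] P by auto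
    then have "C A \<rho> + w i \<le> C A (\<rho> @ ?s)" using i by (intro algorithm_cost_move) auto
    moreover have "w 1 \<le> w i" using i by (intro w_mono) auto
    ultimately show ?thesis by linarith
  qed
  from gain_ge[OF v \<open>G \<in> sets M\<close> \<open>G \<in> sets M\<close> order.refl this]
  have "measure M G * w 1 \<le> gain G \<rho> ?s" .
  moreover have "measure M G * w 1 / 2 \<le> measure M G * w 1" by simp
  ultimately have "measure M G * w (0 + 1) / 2 \<le> gain G \<rho> ?s" unfolding add_0 by (rule order.trans[rotated])
  then show ?case using P by (intro bexI[of _ ?s]) auto
next
  case (Suc l)
  note outer_IH = Suc.IH
  note G = \<open>G \<in> sets M\<close> and away = Suc.prems(6)
  define \<Q> where "\<Q> = family (pts l) P"
  have \<Q>: "finite \<Q>" "card \<Q> \<le> pts l + 1" and \<Q>_sub: "\<forall>Q\<in>\<Q>. Q \<subseteq> P \<and> card Q = pts l"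
    and miss: "\<forall>x. \<exists>Q\<in>\<Q>. x \<notin> Q"
    using covering_family[OF Suc.prems(2)] unfolding covering_def \<Q>_def by blast+
  have \<Q>_ne: "\<Q> \<noteq> {}" using miss by blast
  define S\<^sub>0 where "S\<^sub>0 = (\<Union>Q\<in>\<Q>. attack D l l' Q)"
  define S where "S = (\<Union>Q\<in>\<Q>. attack D l l Q)"
  define m where "m = 2 * (pts l + 1) * D"
  have S_ne: "S\<^sub>0 \<noteq> {}" "S \<noteq> {}"
    unfolding S\<^sub>0_def S_def \<Q>_def
    by (rule attack_segments_nonempty[OF Suc.prems(2) attack_nonempty], assumption)+
  have att: "attack D (Suc l) l' P = runs S\<^sub>0 S m"
    by (simp add: S\<^sub>0_def S_def \<Q>_def m_def)
  have valid: "valid_input k U (\<rho> @ t)" if r: "t \<in> runs S\<^sub>0 S r" "r \<le> m" for t r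
  proof -
    obtain u where "t @ u \<in> runs S\<^sub>0 S m" using runs_extend[OF S_ne r(2,1)] by blast
    then have "valid_input k U ((\<rho> @ t) @ u)" using Suc.prems(4) att by simp
    then show ?thesis by (rule valid_input_append)
  qed
  \<comment> \<open>\<open>y\<close> is the gain of one segment: half of \<open>G\<close>, a
    fraction \<open>1 / (pts l + 1)\<close> of that, times \<open>w (Suc l) / 2\<close> from the
    induction hypothesis. \<open>z\<close> is the target.\<close>
  define y where "y = measure M G * w (Suc l) / (4 * (real (pts l) + 1))"
  define z where "z = measure M G * w (Suc (Suc l)) / 2"
  have "\<exists>t\<in>runs S\<^sub>0 S r. min z (real r * y) \<le> gain G \<rho> t" if "r \<le> m" for r
    using that
  proof (induction r)
    case 0
    then show ?case by simp
  next
    case (Suc r)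
    then obtain t where t: "t \<in> runs S\<^sub>0 S r" "min z (real r * y) \<le> gain G \<rho> t" by auto
    let ?l = "if r = 0 then l' else l"
    have v: "valid_input k U (\<rho> @ t)" using valid[OF t(1)] Suc.prems by simp
    have ext: "t @ s \<in> runs S\<^sub>0 S (Suc r)" if "Q \<in> \<Q>" "s \<in> attack D l ?l Q" for s Q
    proof -
      have "s \<in> (if r = 0 then S\<^sub>0 else S)"
        using that by (auto simp: S\<^sub>0_def S_def)
      then show ?thesis using t(1) unfolding runs.simps by blast
    qed
    have v': "valid_input k U ((\<rho> @ t) @ s)" if "Q \<in> \<Q>" "s \<in> attack D l ?l Q" for s Q
      using valid[OF ext[OF that] Suc.prems] by simp
    have app: "gain G \<rho> (t @ s) = gain G \<rho> t + gain G (\<rho> @ t) s"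
      if "Q \<in> \<Q>" "s \<in> attack D l ?l Q" for s Q
      using v'[OF that] G by (intro gain_append) auto
    show ?case
    proof (cases "z \<le> gain G \<rho> t")
      case True
      obtain Q where Q: "Q \<in> \<Q>" using \<Q>_ne by blast
      then obtain s where s: "s \<in> attack D l ?l Q"
        using attack_nonempty[of Q l D ?l] \<Q>_sub by blast
      have "z \<le> gain G \<rho> (t @ s)"
        using True app[OF Q s] gain_nonneg[OF v'[OF Q s] G] by simp
      then show ?thesis using ext[OF Q s] by (intro bexI[of _ "t @ s"]) auto
    next
      case False
      \<comment> \<open>On \<open>H\<close> some server above \<open>Suc l\<close> has moved into
        \<open>P\<close> and paid at least \<open>w (Suc (Suc l))\<close>. Since the gain is below
        \<open>z\<close>, \<open>H\<close> has less than half the measure of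
        \<open>G\<close>.\<close>
      define H where "H = (\<Union>i\<in>{Suc l + 1..k}. G \<inter> {A \<in> space M. A (\<rho> @ t) i \<in> P})"
      have H: "H \<in> sets M" "H \<subseteq> G"
        unfolding H_def using G v by (auto intro!: sets.finite_UN sets.Int sets_position)
      have "C A \<rho> + w (Suc (Suc l)) \<le> C A (\<rho> @ t)" if "A \<in> H" for A
      proof -
        from that obtain i where i: "i \<in> {Suc l + 1..k}" "A \<in> G" "A (\<rho> @ t) i \<in> P"
          by (auto simp: H_def)
        then have "A (\<rho> @ t) i \<noteq> A \<rho> i" using away[of A i] by auto
        then have "C A \<rho> + w i \<le> C A (\<rho> @ t)" using i(1) by (intro algorithm_cost_move) auto
        moreover have "w (Suc (Suc l)) \<le> w i" using i by (intro w_mono) auto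
        ultimately show ?thesis by linarith
      qed
      from gain_ge[OF v G H this] have "measure M H * w (Suc (Suc l)) \<le> gain G \<rho> t" .
      with False have "measure M H * w (Suc (Suc l)) < measure M G / 2 * w (Suc (Suc l))"
        by (simp add: z_def)
      then have "measure M H < measure M G / 2"
        using D by (simp add: mult_less_cancel_right)
      then have half: "measure M G / 2 \<le> measure M (G - H)"
        using finite_measure_Diff[OF G H] by simp
      \<comment> \<open>On \<open>F Q\<close> every server above \<open>l\<close> avoids
        \<open>Q\<close>: server \<open>Suc l\<close> by definition, the higher ones because outside
        \<open>H\<close> they avoid all of \<open>P\<close>.\<close>
      define F where "F Q = (G - H) \<inter> {A \<in> space M. A (\<rho> @ t) (Suc l) \<in> - Q}" for Q
      have F: "F Q \<in> sets M" for Q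
        unfolding F_def using G H v \<open>Suc l < k\<close> by (intro sets.Int sets.Diff sets_position) auto
      have "G - H \<subseteq> (\<Union>Q\<in>\<Q>. F Q)"
        using miss sets.sets_into_space[OF G] by (fastforce simp: F_def)
      from exists_large_part[OF \<Q> _ F this _ \<Q>_ne] G H
      obtain Q where Q: "Q \<in> \<Q>" "measure M (G - H) / real (pts l + 1) \<le> measure M (F Q)"
        by auto
      have away': "A (\<rho> @ t) i \<notin> Q" if A: "A \<in> F Q" and i: "i \<in> {l + 1..k}" for A i
      proof (cases "i = Suc l")
        case True
        then show ?thesis using A by (auto simp: F_def)
      next
        case False
        then have "A (\<rho> @ t) i \<notin> P"
          using A i sets.sets_into_space[OF G] by (auto simp: F_def H_def)
        then show ?thesis using \<Q>_sub Q(1) by blast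
      qed
      have "l < k" "l \<le> ?l" "card Q = pts l"
        using \<open>Suc l < k\<close> \<open>Suc l \<le> l'\<close> \<Q>_sub Q(1) by auto
      then have "\<exists>s\<in>attack D l ?l Q. measure M (F Q) * w (l + 1) / 2 \<le> gain (F Q) (\<rho> @ t) s"
        using v'[OF Q(1)] F away' by (intro outer_IH) assumption+
      then obtain s where s: "s \<in> attack D l ?l Q"
        and gs: "measure M (F Q) * w (l + 1) / 2 \<le> gain (F Q) (\<rho> @ t) s"
        by blast
      have "y = (measure M G / 2 / real (pts l + 1)) * (w (Suc l) / 2)"
        by (simp add: y_def field_simps)
      also have "\<dots> \<le> measure M (F Q) * (w (Suc l) / 2)"
        using order.trans[OF divide_right_mono[OF half, of "real (pts l + 1)"] Q(2)]
        by (intro mult_right_mono) auto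
      also have "\<dots> \<le> gain (F Q) (\<rho> @ t) s" using gs by simp
      also have "\<dots> \<le> gain G (\<rho> @ t) s"
        using G F by (intro gain_mono[OF v'[OF Q(1) s]]) (auto simp: F_def)
      finally have "real (Suc r) * y \<le> gain G \<rho> (t @ s)"
        using t(2) False app[OF Q(1) s] by (simp add: algebra_simps)
      then show ?thesis using ext[OF Q(1) s] by (intro bexI[of _ "t @ s"]) auto
    qed
  qed
  from this[of m] obtain t where t: "t \<in> runs S\<^sub>0 S m" "min z (real m * y) \<le> gain G \<rho> t" by auto
  \<comment> \<open>The factor \<open>D\<close> in \<open>m\<close> turns \<open>w (Suc l)\<close>
    into \<open>w (Suc (Suc l))\<close>.\<close>
  have "real m * y = z"
    by (simp add: m_def y_def z_def divide_simps) (simp add: algebra_simps)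
  then show ?case using t unfolding att by (intro bexI[of _ t]) (auto simp: z_def)
qed

end

section \<open>Phases\<close>

text \<open>An attack of level \<open>k - 1\<close> needs exactly \<open>n\<close> points even when
  few candidates \<open>S\<close> remain. Padding both halves of \<open>S\<close> keeps the two sets
  disjoint, so server \<open>k\<close> always misses one of them.\<close>

lemma balanced_padding:
  assumes "finite U" "card U = 2 * n" "S \<subseteq> U" "card S = 2 * c" "c \<le> n"
  shows "\<exists>Q\<^sub>0 Q\<^sub>1. Q\<^sub>0 \<subseteq> U \<and> Q\<^sub>1 \<subseteq> U \<and> Q\<^sub>0 \<inter> Q\<^sub>1 = {} \<and> card Q\<^sub>0 = n \<and> card Q\<^sub>1 = n \<and>
    card (S \<inter> Q\<^sub>0) = c \<and> card (S \<inter> Q\<^sub>1) = c"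
proof -
  have finS: "finite S" using assms finite_subset by blast
  obtain S\<^sub>0 where S\<^sub>0: "S\<^sub>0 \<subseteq> S" "card S\<^sub>0 = c"
    using obtain_subset_with_card_n[of c S] assms by auto
  have "card (U - S) = 2 * (n - c)"
    using assms finS by (simp add: card_Diff_subset)
  then obtain E where E: "E \<subseteq> U - S" "card E = n - c"
    using obtain_subset_with_card_n[of "n - c" "U - S"] by auto
  have fin: "finite S\<^sub>0" "finite E"
    using finS S\<^sub>0(1) E(1) assms(1) by (auto intro: finite_subset)
  let ?Q = "S\<^sub>0 \<union> E"
  have Q: "card ?Q = n"
    using S\<^sub>0 E fin assms(5) by (subst card_Un_disjoint) auto
  have "?Q \<subseteq> U" using S\<^sub>0 E assms(3) by auto
  then have "card (U - ?Q) = n"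
    using Q fin assms(2) by (subst card_Diff_subset) auto
  moreover have "S \<inter> ?Q = S\<^sub>0" "S \<inter> (U - ?Q) = S - S\<^sub>0"
    using S\<^sub>0 E assms(3) by auto
  moreover have "card (S - S\<^sub>0) = c"
    using S\<^sub>0 fin assms(4) by (subst card_Diff_subset) auto
  ultimately show ?thesis
    using \<open>?Q \<subseteq> U\<close> Q S\<^sub>0(2)
    by (intro exI[of _ ?Q] exI[of _ "U - ?Q"]) auto
qed

context randomized
begin

text \<open>Carries a run of configurations instead of mere validity, because runs can be continued
  when an attack is appended.\<close>

definition servable :: "nat input \<Rightarrow> bool" where
  "servable \<rho> \<longleftrightarrow> (\<exists>f f'. serves k f \<rho> f') \<and> (\<rho> \<noteq> [] \<longrightarrow> snd (hd \<rho>) = k) \<and>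
     (\<forall>r\<in>set \<rho>. fst r \<in> U \<and> snd r \<le> k)"

lemma servable_valid: "servable \<rho> \<Longrightarrow> valid_input k U \<rho>"
  unfolding servable_def using valid_inputI by blast

text \<open>
  A prefix of a phase, made of \<open>j\<close> attacks, after which every point of \<open>S\<close> is still possible as
  the label of the current interval on level \<open>k\<close>.
\<close>

lemma phase_prefix:
  assumes k: "k \<ge> 1" and U: "finite U" "card U = 2 * pts (k - 1)" and h: "2 ^ h \<le> 2 * pts (k - 1)"
    and \<rho>: "servable \<rho>" and "j \<le> h"
  shows "\<exists>t S. S \<subseteq> U \<and> card S = 2 ^ (h - j) \<and> (t = [] \<longleftrightarrow> j = 0) \<and>
    (\<forall>q\<in>S. \<forall>f. \<exists>f'. serves k f t f' \<and> (\<forall>i>(if j = 0 then k else k - 1). f' i = (f(k := q)) i)) \<and>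
    servable (\<rho> @ t) \<and>
    reveal_cost w t \<le> (if j = 0 then 0 else \<Sum>i = 1..k. w i) + real j * ((2 + overhead (k - 1)) * w (k - 1)) \<and>
    real j * w k / 4 \<le> gain (space M) \<rho> t"
  using \<open>j \<le> h\<close>
proof (induction j)
  case 0
  obtain S where "S \<subseteq> U" "card S = 2 ^ h"
    using obtain_subset_with_card_n[of "2 ^ h" U] U h by auto
  then show ?case using \<rho> by (intro exI[of _ "[]"] exI[of _ S]) auto
next
  case (Suc j)
  let ?l = "if j = 0 then k else k - 1"
  define c :: nat where "c = 2 ^ (h - Suc j)"
  have "j \<le> h" using Suc.prems by simp
  from Suc.IH[OF this] obtain t S where S: "S \<subseteq> U" "card S = 2 ^ (h - j)" and t: "t = [] \<longleftrightarrow> j = 0"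
    and srv: "\<And>q f. q \<in> S \<Longrightarrow> \<exists>f'. serves k f t f' \<and> (\<forall>i>?l. f' i = (f(k := q)) i)"
    and sv: "servable (\<rho> @ t)"
    and rc: "reveal_cost w t \<le> (if j = 0 then 0 else \<Sum>i = 1..k. w i) + real j * ((2 + overhead (k - 1)) * w (k - 1))"
    and gn: "real j * w k / 4 \<le> gain (space M) \<rho> t"
    by blast
  have "h - j = Suc (h - Suc j)" using Suc.prems by simp
  then have cS: "card S = 2 * c" using S(2) by (simp add: c_def)
  have "2 * c \<le> 2 ^ h" unfolding c_def power_Suc[symmetric]
    using Suc.prems by (intro power_increasing) auto
  then have "c \<le> pts (k - 1)" using h by linarith
  from balanced_padding[OF U S(1) cS this] obtain Q\<^sub>0 Q\<^sub>1 where
    Q: "Q\<^sub>0 \<subseteq> U" "Q\<^sub>1 \<subseteq> U" "Q\<^sub>0 \<inter> Q\<^sub>1 = {}" "card Q\<^sub>0 = pts (k - 1)" "card Q\<^sub>1 = pts (k - 1)"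
      "card (S \<inter> Q\<^sub>0) = c" "card (S \<inter> Q\<^sub>1) = c" by blast
  define F where "F Q = {A \<in> space M. A (\<rho> @ t) k \<in> - Q}" for Q
  have F: "F Q \<in> sets M" for Q
    unfolding F_def using k by (intro sets_position servable_valid[OF sv]) auto
  have "space M \<subseteq> (\<Union>Q\<in>{Q\<^sub>0, Q\<^sub>1}. F Q)" using Q(3) by (auto simp: F_def)
  moreover have "card {Q\<^sub>0, Q\<^sub>1} \<le> 2" by (simp add: card_insert_if)
  ultimately have "\<exists>Q\<in>{Q\<^sub>0, Q\<^sub>1}. measure M (space M) / real 2 \<le> measure M (F Q)"
    using F by (intro exists_large_part) simp_all
  then obtain Q where "Q \<in> {Q\<^sub>0, Q\<^sub>1}" and half: "1 / 2 \<le> measure M (F Q)"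
    unfolding prob_space by auto
  then have Q: "Q \<subseteq> U" "card Q = pts (k - 1)" "card (S \<inter> Q) = c" using Q by auto
  have att: "\<exists>f'. serves k f (t @ s) f' \<and> (\<forall>i>k - 1. f' i = (f(k := q)) i)"
    if s: "s \<in> attack D (k - 1) ?l Q" and q: "q \<in> S \<inter> Q" for s q f
  proof -
    obtain f' where f': "serves k f t f'" "\<And>i. ?l < i \<Longrightarrow> f' i = (f(k := q)) i"
      using srv[of q f] q by blast
    \<comment> \<open>The label \<open>q\<close> of level \<open>k\<close> lies in \<open>Q\<close>,
      so level \<open>k\<close> itself is the level above the attack that makes it servable. This is
      why the candidates shrink to \<open>S \<inter> Q\<close>.\<close>
    have "\<exists>f''. serves k f' s f'' \<and> (\<forall>i>k - 1. f'' i = (f(k := q)) i)"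
      by (rule attack_serves[OF s Q(2), of k]) (use q k D f'(2) in auto)
    then obtain f'' where "serves k f' s f''" "\<forall>i>k - 1. f'' i = (f(k := q)) i" by blast
    then show ?thesis using f'(1) by (auto simp: serves_append)
  qed
  have sv': "servable ((\<rho> @ t) @ s)" if s: "s \<in> attack D (k - 1) ?l Q" for s
    unfolding servable_def
  proof (intro conjI impI ballI)
    have "S \<inter> Q \<noteq> {}" using Q(3) by (auto simp: c_def)
    then obtain q where q: "q \<in> S \<inter> Q" by blast
    from \<rho> obtain f f' where "serves k f \<rho> f'" by (auto simp: servable_def)
    then show "\<exists>f f'. serves k f ((\<rho> @ t) @ s) f'"
      using att[OF s q, of f'] by (auto simp: serves_append)
    show "snd (hd ((\<rho> @ t) @ s)) = k"
    proof (cases "\<rho> @ t = []")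
      case True
      then show ?thesis using t attack_hd[OF s] D by auto
    next
      case False
      then have "snd (hd (\<rho> @ t)) = k" using sv unfolding servable_def by blast
      then show ?thesis using hd_append2[OF False, of s] by (simp only:)
    qed
    fix r assume "r \<in> set ((\<rho> @ t) @ s)"
    moreover have "fst r \<in> U \<and> snd r \<le> k" if "r \<in> set s"
    proof -
      have "fst r \<in> Q \<and> snd r \<le> ?l" by (rule attack_range[OF s Q(2) _ that]) simp
      moreover have "?l \<le> k" by simp
      ultimately show ?thesis using Q(1) by (meson order.trans subsetD)
    qed
    ultimately show "fst r \<in> U" "snd r \<le> k" using sv by (auto simp: servable_def)
  qed
  have valid: "valid_input k U ((\<rho> @ t) @ s)" if "s \<in> attack D (k - 1) ?l Q" for s
    using sv'[OF that] by (rule servable_valid)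
  have "k - 1 < k" "k - 1 \<le> ?l" using k by auto
  moreover have "A (\<rho> @ t) i \<notin> Q" if "A \<in> F Q" "i \<in> {k - 1 + 1..k}" for A i
    using that k by (auto simp: F_def)
  ultimately obtain s where s: "s \<in> attack D (k - 1) ?l Q"
    and gs: "measure M (F Q) * w (k - 1 + 1) / 2 \<le> gain (F Q) (\<rho> @ t) s"
    using attack_gain[OF _ Q(2) _ valid F] by blast
  have "w k / 4 \<le> measure M (F Q) * w (k - 1 + 1) / 2"
    using mult_right_mono[OF half, of "w k"] k by simp
  also note gs
  also have "gain (F Q) (\<rho> @ t) s \<le> gain (space M) (\<rho> @ t) s"
    by (intro gain_mono valid[OF s] F) (auto simp: F_def)
  finally have gs': "w k / 4 \<le> gain (space M) (\<rho> @ t) s" .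
  have "gain (space M) \<rho> (t @ s) = gain (space M) \<rho> t + gain (space M) (\<rho> @ t) s"
    using valid[OF s] by (intro gain_append) auto
  with gs' gn have 1: "real (Suc j) * w k / 4 \<le> gain (space M) \<rho> (t @ s)"
    by (simp add: field_simps)
  have pos: "0 \<le> w (k - 1)" by simp
  have W: "(\<Sum>i = 1..k - 1. w i) \<le> 2 * w (k - 1)"
    using D by (intro sum_powers_le) auto
  have "reveal_cost w s \<le> (\<Sum>i = 1..?l. w i) + overhead (k - 1) * w (k - 1)"
    by (rule attack_cost[OF s D])
  \<comment> \<open>Only the first attack of a phase starts intervals on level \<open>k\<close>; a
    later one starts levels up to \<open>k - 1\<close>, for at most
    \<open>2 * w (k - 1)\<close>.\<close>
  also have "\<dots> \<le> (if j = 0 then (\<Sum>i = 1..k. w i) else 0) + (2 + overhead (k - 1)) * w (k - 1)"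
    unfolding distrib_right using W pos by auto
  finally have 2: "reveal_cost w (t @ s) \<le> (\<Sum>i = 1..k. w i) + real (Suc j) * ((2 + overhead (k - 1)) * w (k - 1))"
    using rc unfolding reveal_cost_simps of_nat_Suc distrib_right[of 1 "real j"]
    by (auto split: if_splits)
  have "s \<noteq> []" using attack_hd[OF s] D by simp
  then show ?case
    using Q S(1) att[OF s] sv'[OF s] 1 2
    by (intro exI[of _ "t @ s"] exI[of _ "S \<inter> Q"]) (auto simp: c_def)
qed

text \<open>Repeating phases outweighs any additive constant. A phase is charged at most
  \<open>2 * w k\<close> for its first round and, by the choice of \<open>D\<close>, at most
  \<open>w k\<close> for everything else.\<close>

lemma phases:
  assumes k: "k \<ge> 1" and U: "finite U" "card U = 2 * pts (k - 1)" and h: "2 ^ h \<le> 2 * pts (k - 1)"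
    and large: "real h * (2 + overhead (k - 1)) \<le> real D"
  shows "\<exists>\<rho>. servable \<rho> \<and> reveal_cost w \<rho> \<le> real n * (3 * w k) \<and>
    real n * (real h * w k / 4) \<le> (\<integral>A. C A \<rho> \<partial>M)"
proof (induction n)
  case 0
  show ?case
    by (intro exI[of _ "[]"]) (simp add: servable_def algorithm_cost_def moves_def)
next
  case (Suc n)
  then obtain \<rho> where \<rho>: "servable \<rho>" "reveal_cost w \<rho> \<le> real n * (3 * w k)"
    "real n * (real h * w k / 4) \<le> (\<integral>A. C A \<rho> \<partial>M)" by blast
  from phase_prefix[OF k U h \<rho>(1) order.refl] obtain t where t: "servable (\<rho> @ t)"
    "reveal_cost w t \<le> (if h = 0 then 0 else \<Sum>i = 1..k. w i) + real h * ((2 + overhead (k - 1)) * w (k - 1))"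
    "real h * w k / 4 \<le> gain (space M) \<rho> t" by blast
  have wk: "w k = real D * w (k - 1)" using k by (cases k) auto
  have "(if h = 0 then 0 else \<Sum>i = 1..k. w i) \<le> 2 * w k"
    using sum_powers_le[of "real D" k] D by simp
  moreover have "real h * ((2 + overhead (k - 1)) * w (k - 1)) \<le> w k"
    unfolding wk mult.assoc[symmetric] using large by (intro mult_right_mono) auto
  ultimately have "reveal_cost w t \<le> 3 * w k" using t(2) by linarith
  then have 1: "reveal_cost w (\<rho> @ t) \<le> real (Suc n) * (3 * w k)"
    using \<rho>(2) by (simp add: algebra_simps)
  have "gain (space M) \<rho> t = (\<integral>A. C A (\<rho> @ t) - C A \<rho> \<partial>M)"
    unfolding gain_def by (rule Bochner_Integration.integral_cong) auto
  also have "\<dots> = (\<integral>A. C A (\<rho> @ t) \<partial>M) - (\<integral>A. C A \<rho> \<partial>M)"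
    using t(1) \<rho>(1) by (intro Bochner_Integration.integral_diff integrable_cost servable_valid)
  finally have "real (Suc n) * (real h * w k / 4) \<le> (\<integral>A. C A (\<rho> @ t) \<partial>M)"
    using t(3) \<rho>(3) by (simp add: algebra_simps)
  with 1 t(1) show ?case by blast
qed

lemma competitive_ratio_lower_bound:
  assumes k: "k \<ge> 1" and U: "finite U" "card U = 2 * pts (k - 1)" and h: "2 ^ h \<le> 2 * pts (k - 1)"
    and large: "real h * (2 + overhead (k - 1)) \<le> real D"
    and "h \<ge> 1" and comp: "competitive k w U \<alpha> M"
  shows "real h / 12 \<le> \<alpha>"
proof (rule ccontr)
  assume less: "\<not> real h / 12 \<le> \<alpha>"
  \<comment> \<open>Only an upper bound on the pattern cost is known, so the factor must be
    nonnegative. \<open>d\<close> is the surplus per phase: a gain of \<open>h / 4\<close> against a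
    charge of 3, in units of \<open>w k\<close>.\<close>
  define \<beta> where "\<beta> = max \<alpha> 0"
  define d where "d = (real h / 4 - 3 * \<beta>) * w k"
  have "0 < real h / 4 - 3 * \<beta>"
    using less \<open>h \<ge> 1\<close> by (auto simp: \<beta>_def max_def)
  then have d: "0 < d" using D by (simp add: d_def)
  from comp obtain b where b: "\<And>\<rho>. valid_input k U \<rho> \<Longrightarrow>
      (\<integral>A. C A \<rho> \<partial>M) \<le> \<alpha> * pattern_cost k w (revealed_pattern \<rho> (length \<rho>)) + b"
    unfolding competitive_def by blast
  have "real n * d \<le> b" for n
  proof -
    obtain \<rho> where \<rho>: "servable \<rho>" "reveal_cost w \<rho> \<le> real n * (3 * w k)"
      "real n * (real h * w k / 4) \<le> (\<integral>A. C A \<rho> \<partial>M)"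
      using phases[OF k U h large, of n] by blast
    let ?c = "pattern_cost k w (revealed_pattern \<rho> (length \<rho>))"
    have "0 \<le> ?c" by (simp add: pattern_cost_def sum_nonneg)
    moreover have "?c \<le> real n * (3 * w k)"
      using pattern_cost_revealed[OF servable_valid[OF \<rho>(1)], of w] \<rho>(2) by simp
    ultimately have "\<alpha> * ?c \<le> \<beta> * (real n * (3 * w k))"
      by (intro mult_mono) (auto simp: \<beta>_def)
    with \<rho>(3) b[OF servable_valid[OF \<rho>(1)]]
    have "real n * (real h * w k / 4) \<le> \<beta> * (real n * (3 * w k)) + b" by linarith
    then show ?thesis by (simp add: d_def algebra_simps)
  qed
  moreover obtain n where "b < real n * d" using reals_Archimedean3[OF d] by blast
  ultimately show False by (meson linorder_not_le)
qed

end

section \<open>Choice of the parameters\<close>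

lemma attack_length:
  assumes "k \<ge> 1"
  shows "2 ^ 2 ^ (k - 4) \<le> 2 * pts (k - 1)"
proof (cases "k \<ge> 4")
  case True
  then have "k - 1 = k - 4 + 3" by simp
  then have "4 * 2 ^ 2 ^ (k - 4) \<le> pts (k - 1)" using pts_growth[of "k - 4"] by (simp only:)
  then show ?thesis by linarith
next
  case False
  \<comment> \<open>Truncated subtraction reduces the claim to
    \<open>2 \<le> 2 * pts (k - 1)\<close>.\<close>
  then have "k - 4 = 0" by simp
  then show ?thesis using pts_pos[of "k - 1"] by (simp only: power_0 power_one_right)
qed

theorem theorem3:
  shows "\<exists>c::real. c > 0 \<and> (\<forall>k::nat. k \<ge> 1 \<longrightarrow>
    (\<exists>(w :: nat \<Rightarrow> real) (U :: nat set).
       (\<forall>i\<in>{1..k}. w i > 0) \<and> mono_on {1..k} w \<and> finite U \<and> U \<noteq> {} \<and>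
       \<not> (\<exists>(M :: nat algorithm measure) (\<alpha> :: real).
            randomized_algorithm k U M \<and> competitive k w U \<alpha> M \<and> \<alpha> < c * 2 ^ k)))"
proof (intro exI[of _ "1 / 256 :: real"] conjI allI impI)
  fix k :: nat assume k: "k \<ge> 1"
  define h :: nat where "h = 2 ^ (k - 4)"
  \<comment> \<open>Not circular, as \<open>overhead\<close> does not involve
    \<open>D\<close>.\<close>
  define D where "D = nat \<lceil>real h * (2 + overhead (k - 1))\<rceil> + 2"
  define U where "U = {..<2 * pts (k - 1)}"
  have large: "D \<ge> 2" "real h * (2 + overhead (k - 1)) \<le> real D"
    by (simp_all add: D_def) linarith
  have h: "h \<ge> 1" "2 ^ h \<le> 2 * pts (k - 1)"
    using attack_length[OF k] by (simp_all add: h_def)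
  have U: "finite U" "card U = 2 * pts (k - 1)" by (simp_all add: U_def)
  have "U \<noteq> {}" using pts_pos[of "k - 1"] by (auto simp: U_def lessThan_empty_iff)
  \<comment> \<open>Truncation only helps here: \<open>2 ^ k \<le> 16 * h\<close> for all
    \<open>k\<close>, so \<open>2 ^ k / 256\<close> is at most \<open>h / 16\<close>, below
    \<open>h / 12\<close>.\<close>
  have "(2::real) ^ k \<le> 2 ^ (k - 4 + 4)" by (intro power_increasing) auto
  then have "2 ^ k \<le> 16 * real h" unfolding power_add by (simp add: h_def)
  then have c: "1 / 256 * 2 ^ k \<le> real h / 12" by linarith
  have "\<not> (\<exists>(M :: nat algorithm measure) (\<alpha> :: real).
      randomized_algorithm k U M \<and> competitive k (\<lambda>i. real D ^ i) U \<alpha> M \<and> \<alpha> < 1 / 256 * 2 ^ k)"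
  proof (intro notI, elim exE conjE)
    fix M \<alpha> assume M: "randomized_algorithm k U M" and comp: "competitive k (\<lambda>i. real D ^ i) U \<alpha> M"
      and less: "\<alpha> < 1 / 256 * 2 ^ k"
    interpret randomized k D U M by unfold_locales (use M large in auto)
    show False
      using competitive_ratio_lower_bound[OF k U h(2) large(2) h(1) comp] c less by linarith
  qed
  moreover have "mono_on {1..k} (\<lambda>i. real D ^ i)"
    using large by (intro mono_onI power_increasing) auto
  ultimately show "\<exists>(w :: nat \<Rightarrow> real) (U :: nat set).
       (\<forall>i\<in>{1..k}. w i > 0) \<and> mono_on {1..k} w \<and> finite U \<and> U \<noteq> {} \<and>
       \<not> (\<exists>(M :: nat algorithm measure) (\<alpha> :: real).
            randomized_algorithm k U M \<and> competitive k w U \<alpha> M \<and> \<alpha> < 1 / 256 * 2 ^ k)"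
    using U(1) \<open>U \<noteq> {}\<close> large(1)
    by (intro exI[of _ "\<lambda>i. real D ^ i"] exI[of _ U] conjI ballI) (simp, assumption+)
qed simp

end
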